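(* Let $f:\Sigma^*\to\Sigma^*$ be a partial recursive function. There is a constant $c$ depending only on $f$ such that for all $x\in\Sigma^*$, $$\mathbf{I}(f(x);\mathcal{H}) < \mathbf{I}(x;\mathcal{H})+c.$$
   Context: $\Sigma=\{0,1\}$, $\Sigma^*$ the finite binary strings, $\perp$ the empty string. $\mathbf{K}(x\mid z)$ is prefix Kolmogorov complexity relative to auxiliary input $z$ with respect to a fixed universal prefix-free machine $U_z$; $\mathbf{K}(x)=\mathbf{K}(x\mid\perp)$. $\mathcal{H}$ is the halting sequence (characteristic sequence of the domain of $U$), and $\mathbf{I}(x;\mathcal{H})=\mathbf{K}(x)-\mathbf{K}(x\mid\mathcal{H})$. A partial recursive function $f$ is one computed by a Turing machine $T$, with the convention $f(x)=\perp$ if $T$ halts without output or does not halt on $x$. *)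

theory Defs
  imports Main "HOL-Library.Sublist"
begin

datatype rf = Zero | Succ | Proj nat | Comp rf "rf list" | Prec rf rf | Mu rf | Orc

inductive eval :: "(nat \<Rightarrow> bool) \<Rightarrow> rf \<Rightarrow> nat list \<Rightarrow> nat \<Rightarrow> bool" for A where
  ev_zero: "eval A Zero xs 0"
| ev_succ: "eval A Succ (x # xs) (Suc x)"
| ev_proj: "i < length xs \<Longrightarrow> eval A (Proj i) xs (xs ! i)"
| ev_comp: "length ys = length gs \<Longrightarrow> (\<forall>i<length gs. eval A (gs ! i) xs (ys ! i))
            \<Longrightarrow> eval A f ys z \<Longrightarrow> eval A (Comp f gs) xs z"
| ev_prec0: "eval A f ys z \<Longrightarrow> eval A (Prec f g) (0 # ys) z"
| ev_precS: "eval A (Prec f g) (n # ys) z \<Longrightarrow> eval A g (n # z # ys) w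
            \<Longrightarrow> eval A (Prec f g) (Suc n # ys) w"
| ev_mu: "eval A f (n # ys) 0 \<Longrightarrow> (\<forall>m<n. \<exists>k. eval A f (m # ys) (Suc k))
            \<Longrightarrow> eval A (Mu f) ys n"
| ev_orc: "eval A Orc (n # xs) (if A n then 1 else 0)"

definition compute :: "(nat \<Rightarrow> bool) \<Rightarrow> rf \<Rightarrow> nat list \<Rightarrow> nat option" where
  "compute A M xs = (if \<exists>y. eval A M xs y then Some (THE y. eval A M xs y) else None)"

fun str_nat :: "bool list \<Rightarrow> nat" where
  "str_nat [] = 0"
| "str_nat (b # xs) = 2 * str_nat xs + (if b then 2 else 1)"

fun nat_str :: "nat \<Rightarrow> bool list" where
  "nat_str n = (if n = 0 then [] else if odd n then False # nat_str ((n - 1) div 2)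
                else True # nat_str ((n - 2) div 2))"

definition run :: "(nat \<Rightarrow> bool) \<Rightarrow> rf \<Rightarrow> bool list \<Rightarrow> bool list option" where
  "run A M p = map_option nat_str (compute A M [str_nat p])"

definition no_oracle :: "nat \<Rightarrow> bool" where
  "no_oracle = (\<lambda>_. False)"

definition prefix_free_machine :: "rf \<Rightarrow> bool" where
  "prefix_free_machine M \<longleftrightarrow>
     (\<forall>A p q. run A M p \<noteq> None \<longrightarrow> run A M q \<noteq> None \<longrightarrow> prefix p q \<longrightarrow> p = q)"

definition universal :: "rf \<Rightarrow> bool" where
  "universal U \<longleftrightarrow> prefix_free_machine U \<and>
     (\<forall>M. prefix_free_machine M \<longrightarrow> (\<exists>q. \<forall>A p. run A U (q @ p) = run A M p))"

definition KA :: "rf \<Rightarrow> (nat \<Rightarrow> bool) \<Rightarrow> bool list \<Rightarrow> nat" where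
  "KA U A x = (LEAST n. \<exists>p. length p = n \<and> run A U p = Some x)"

definition K :: "rf \<Rightarrow> bool list \<Rightarrow> nat" where
  "K U x = KA U no_oracle x"

definition halting_seq :: "rf \<Rightarrow> nat \<Rightarrow> bool" where
  "halting_seq U n \<longleftrightarrow> run no_oracle U (nat_str n) \<noteq> None"

definition KH :: "rf \<Rightarrow> bool list \<Rightarrow> nat" where
  "KH U x = KA U (halting_seq U) x"

definition IH :: "rf \<Rightarrow> bool list \<Rightarrow> int" where
  "IH U x = int (K U x) - int (KH U x)"

definition partial_recursive :: "(bool list \<Rightarrow> bool list) \<Rightarrow> bool" where
  "partial_recursive f \<longleftrightarrow> (\<exists>M. \<forall>x. f x =
     (case run no_oracle M x of None \<Rightarrow> [] | Some y \<Rightarrow> y))"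

end

theory Submission
  imports Defs Complex_Main "HOL-Library.Nat_Bijection"
begin

text \<open>Let \<open>y = f x\<close>. The claim amounts to \<open>K(y) + K(x|H) \<le> K(x) + K(y|H) + O(1)\<close>.
  Let \<open>m(y)\<close> be the probability that the composition of \<open>U\<close> and \<open>f\<close> outputs \<open>y\<close>, and let \<open>k\<close> be the
  least number with \<open>2 ^ -k \<le> m(y)\<close>. By the coding theorem \<open>K(y) \<le> k + O(1)\<close>. Conversely, the
  programs \<open>p\<close> with \<open>f(U(p)) = y\<close> can be enumerated, and their weights \<open>2 ^ -|p|\<close> sum to less than
  \<open>2 ^ (1 - k)\<close>. So, once \<open>y\<close> and \<open>k\<close> are known, the shortest program for \<open>x\<close> has a prefix-free
  code of length \<open>K(x) - k + O(1)\<close>; and the halting sequence computes \<open>k\<close> from \<open>y\<close>. Hence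
  \<open>K(x|H) \<le> K(y|H) + K(x) - k + O(1)\<close>, and the sum of the two bounds is the claim. If \<open>f\<close> is
  undefined at \<open>x\<close>, the left side is a constant and \<open>K(x|H) \<le> K(x) + O(1)\<close> suffices.\<close>

section \<open>Functions computable relative to an oracle\<close>

text \<open>The number \<open>k\<close> stands in for \<open>K(y)\<close> because the pairs
  \<open>(y, k)\<close> whose threshold \<open>2 ^ -k\<close> is crossed at a finite stage can be
  enumerated, so that one query to the halting sequence decides such a pair. What is coded relative
  to \<open>y\<close> is the shortest program \<open>p\<close> of \<open>x\<close>, not
  \<open>x\<close> itself: the weights \<open>2 ^ -|p|\<close> obey Kraft's inequality and can be
  normalised by the mass of \<open>y\<close>, and running \<open>p\<close> without an oracle returns
  \<open>x\<close>. The obstacle that shapes the proof is that \<open>universal\<close> simulates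
  only machines that are prefix-free under every oracle, although their output matters under one.
  Hence a code is a decidable relation whose prefix-freeness does not rest on the Kraft sum, and
  every machine is an unbounded search for a witness of such a relation. The additive constants are
  the lengths of the prefixes that select these machines, plus a few rounding bits.\<close>

inductive_cases eval_zeroE: "eval A Zero xs y"
inductive_cases eval_succE: "eval A Succ xs y"
inductive_cases eval_projE: "eval A (Proj i) xs y"
inductive_cases eval_compE: "eval A (Comp f gs) xs y"
inductive_cases eval_prec_0E: "eval A (Prec f g) (0 # xs) y"
inductive_cases eval_prec_SucE: "eval A (Prec f g) (Suc n # xs) y"
inductive_cases eval_muE: "eval A (Mu f) xs y"
inductive_cases eval_orcE: "eval A Orc xs y"

lemma eval_deterministic: "eval A M xs y \<Longrightarrow> eval A M xs z \<Longrightarrow> y = z"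
proof (induction arbitrary: z rule: eval.induct)
  case (ev_comp ys gs xs f w)
  from ev_comp.prems obtain zs where zs: "length zs = length gs"
    "\<forall>i<length gs. eval A (gs ! i) xs (zs ! i)" "eval A f zs z"
    by (auto elim: eval_compE)
  have "ys = zs" using ev_comp zs by (auto intro: nth_equalityI)
  with ev_comp zs show ?case by blast
next
  case (ev_mu f n ys)
  from ev_mu.prems have z: "eval A f (z # ys) 0" "\<forall>m<z. \<exists>k. eval A f (m # ys) (Suc k)"
    by (auto elim: eval_muE)
  have "\<not> z < n" using ev_mu.IH(2) z(1) by fastforce
  moreover have "\<not> n < z" using ev_mu.IH(1) z(2) by fastforce
  ultimately show ?case by simp
next
  case ev_prec0
  then show ?case by (blast elim: eval_prec_0E)
next
  case ev_precS
  then show ?case by (blast elim: eval_prec_SucE)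
qed (auto elim: eval_zeroE eval_succE eval_projE eval_orcE)

lemma compute_eq_Some_iff: "compute A M xs = Some y \<longleftrightarrow> eval A M xs y"
  unfolding compute_def by (auto intro: theI dest: eval_deterministic)

text \<open>Total functions only, and the term \<open>M\<close> is chosen before the oracle:
  \<open>universal\<close> compares machines under all oracles at once, so one term must serve them
  all.\<close>

definition recursive_in :: "nat \<Rightarrow> ((nat \<Rightarrow> bool) \<Rightarrow> nat list \<Rightarrow> nat) \<Rightarrow> bool" where
  "recursive_in n F \<longleftrightarrow> (\<exists>M. \<forall>A xs. length xs = n \<longrightarrow> eval A M xs (F A xs))"

definition decidable_in :: "nat \<Rightarrow> ((nat \<Rightarrow> bool) \<Rightarrow> nat list \<Rightarrow> bool) \<Rightarrow> bool" where
  "decidable_in n P \<longleftrightarrow> recursive_in n (\<lambda>A xs. of_bool (P A xs))"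

lemma recursive_in_cong:
  "(\<And>A xs. length xs = n \<Longrightarrow> F A xs = G A xs) \<Longrightarrow> recursive_in n F \<longleftrightarrow> recursive_in n G"
  unfolding recursive_in_def by auto

lemma recursive_in_compose:
  assumes "recursive_in m G"
    and "\<And>A xs. length xs = n \<Longrightarrow> length (L A xs) = m"
    and "\<And>i. i < m \<Longrightarrow> recursive_in n (\<lambda>A xs. L A xs ! i)"
  shows "recursive_in n (\<lambda>A xs. G A (L A xs))"
proof -
  from assms(1) obtain g where g: "\<And>A xs. length xs = m \<Longrightarrow> eval A g xs (G A xs)"
    unfolding recursive_in_def by blast
  from assms(3) have "\<forall>i. \<exists>M. i < m \<longrightarrow> (\<forall>A xs. length xs = n \<longrightarrow> eval A M xs (L A xs ! i))"
    unfolding recursive_in_def by blast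
  then obtain h where h: "\<And>i A xs. i < m \<Longrightarrow> length xs = n \<Longrightarrow> eval A (h i) xs (L A xs ! i)"
    by metis
  show ?thesis unfolding recursive_in_def
  proof (intro exI allI impI)
    fix A and xs :: "nat list" assume "length xs = n"
    then show "eval A (Comp g (map h [0..<m])) xs (G A (L A xs))"
      using assms(2) h g by (intro ev_comp[where ys = "L A xs"]) auto
  qed
qed

lemma recursive_in_const: "recursive_in n (\<lambda>A xs. c)"
proof (induction c)
  case 0
  show ?case unfolding recursive_in_def by (auto intro: ev_zero)
next
  case (Suc c)
  have "recursive_in 1 (\<lambda>A xs. Suc (hd xs))"
    unfolding recursive_in_def by (auto simp: length_Suc_conv intro!: exI[of _ Succ] ev_succ)
  from recursive_in_compose[OF this, of n "\<lambda>A xs. [c]"] Suc show ?case by simp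
qed

lemma recursive_in_nth: "i < n \<Longrightarrow> recursive_in n (\<lambda>A xs. xs ! i)"
  unfolding recursive_in_def using ev_proj by blast

text \<open>Recursion, sums and bounded quantifiers put their bound variable in front of the
  argument list, so outer arguments appear below one or more \<open>tl\<close>.\<close>

lemma recursive_in_tl_nth: "Suc i < n \<Longrightarrow> recursive_in n (\<lambda>A xs. tl xs ! i)"
  by (subst recursive_in_cong[where G = "\<lambda>A xs. xs ! Suc i"]) (auto simp: nth_tl recursive_in_nth)

lemma recursive_in_tl_tl_nth: "Suc (Suc i) < n \<Longrightarrow> recursive_in n (\<lambda>A xs. tl (tl xs) ! i)"
  by (subst recursive_in_cong[where G = "\<lambda>A xs. xs ! Suc (Suc i)"]) (auto simp: nth_tl recursive_in_nth)

lemma recursive_in_tl_tl_tl_nth: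
  "Suc (Suc (Suc i)) < n \<Longrightarrow> recursive_in n (\<lambda>A xs. tl (tl (tl xs)) ! i)"
  by (subst recursive_in_cong[where G = "\<lambda>A xs. xs ! Suc (Suc (Suc i))"])
    (auto simp: nth_tl recursive_in_nth)

lemma recursive_in_hd: "0 < n \<Longrightarrow> recursive_in n (\<lambda>A xs. hd xs)"
  by (subst recursive_in_cong[where G = "\<lambda>A xs. xs ! 0"]) (auto simp: hd_conv_nth recursive_in_nth)

lemma recursive_in_hd_tl: "Suc 0 < n \<Longrightarrow> recursive_in n (\<lambda>A xs. hd (tl xs))"
  by (subst recursive_in_cong[where G = "\<lambda>A xs. tl xs ! 0"])
    (auto simp: recursive_in_tl_nth length_Suc_conv Suc_le_length_iff less_eq_Suc_le)

lemma recursive_in_hd_tl_tl: "Suc (Suc 0) < n \<Longrightarrow> recursive_in n (\<lambda>A xs. hd (tl (tl xs)))"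
  by (subst recursive_in_cong[where G = "\<lambda>A xs. tl (tl xs) ! 0"])
    (auto simp: recursive_in_tl_tl_nth length_Suc_conv Suc_le_length_iff less_eq_Suc_le)

lemmas recursive_in_vars =
  recursive_in_nth recursive_in_tl_nth recursive_in_tl_tl_nth recursive_in_tl_tl_tl_nth
  recursive_in_hd recursive_in_hd_tl recursive_in_hd_tl_tl

lemma recursive_in_unary:
  assumes "recursive_in 1 (\<lambda>A xs. h A (hd xs))" "recursive_in n F"
  shows "recursive_in n (\<lambda>A xs. h A (F A xs))"
  using recursive_in_compose[OF assms(1), of n "\<lambda>A xs. [F A xs]"] assms(2) by simp

lemma recursive_in_Suc: "recursive_in n F \<Longrightarrow> recursive_in n (\<lambda>A xs. Suc (F A xs))"
  by (rule recursive_in_unary[where h = "\<lambda>A. Suc"])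
    (auto simp: recursive_in_def length_Suc_conv intro!: exI[of _ Succ] ev_succ)

lemma decidable_in_oracle: "recursive_in n F \<Longrightarrow> decidable_in n (\<lambda>A xs. A (F A xs))"
  unfolding decidable_in_def
proof (rule recursive_in_unary[where h = "\<lambda>A x. of_bool (A x)"])
  have "eval A Orc [y] (of_bool (A y))" for A y
    using ev_orc[of A y "[]"] by (simp add: of_bool_def)
  then have "eval A Orc xs (of_bool (A (hd xs)))" if "length xs = 1" for A xs
    using that by (cases xs) (auto simp del: of_bool_eq_1_iff of_bool_eq_0_iff split del: if_split)
  then show "recursive_in 1 (\<lambda>A xs. of_bool (A (hd xs)))"
    unfolding recursive_in_def by blast
qed

lemma recursive_in_rec_nat:
  assumes "recursive_in n F" "recursive_in (Suc (Suc n)) (\<lambda>A zs. G A (tl (tl zs)) (hd zs) (hd (tl zs)))"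
    "recursive_in n N"
  shows "recursive_in n (\<lambda>A xs. rec_nat (F A xs) (G A xs) (N A xs))"
proof -
  obtain f where f: "\<And>A xs. length xs = n \<Longrightarrow> eval A f xs (F A xs)"
    using assms(1) unfolding recursive_in_def by blast
  obtain g where g: "\<And>A zs. length zs = Suc (Suc n) \<Longrightarrow>
      eval A g zs (G A (tl (tl zs)) (hd zs) (hd (tl zs)))"
    using assms(2) unfolding recursive_in_def by blast
  have "eval A (Prec f g) (k # xs) (rec_nat (F A xs) (G A xs) k)" if "length xs = n" for A xs k
  proof (induction k)
    case 0
    show ?case using f[OF that] by (auto intro: ev_prec0)
  next
    case (Suc k)
    show ?case using g[of "k # rec_nat (F A xs) (G A xs) k # xs"] that
      by (auto intro: ev_precS[OF Suc])
  qed
  then have "recursive_in (Suc n) (\<lambda>A zs. rec_nat (F A (tl zs)) (G A (tl zs)) (hd zs))"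
    unfolding recursive_in_def by (intro exI[of _ "Prec f g"]) (auto simp: length_Suc_conv)
  moreover have "recursive_in n (\<lambda>A xs. (N A xs # xs) ! i)" if "i < Suc n" for i
    using that assms(3) by (cases i) (auto intro: recursive_in_nth)
  ultimately show ?thesis
    using recursive_in_compose[where L = "\<lambda>A xs. N A xs # xs" and n = n and m = "Suc n"] by force
qed

lemma recursive_in_add:
  assumes "recursive_in n F" "recursive_in n G"
  shows "recursive_in n (\<lambda>A xs. F A xs + G A xs)"
proof -
  have eq: "a + b = rec_nat a (\<lambda>_ r. Suc r) b" for a b :: nat by (induction b) auto
  show ?thesis unfolding eq
    by (intro recursive_in_rec_nat recursive_in_Suc recursive_in_vars assms) auto
qed

lemma recursive_in_pred:
  assumes "recursive_in n F"
  shows "recursive_in n (\<lambda>A xs. F A xs - Suc 0)"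
proof -
  have eq: "a - Suc 0 = rec_nat 0 (\<lambda>k _. k) a" for a :: nat by (induction a) auto
  show ?thesis unfolding eq
    by (intro recursive_in_rec_nat recursive_in_const recursive_in_vars assms) auto
qed

lemma recursive_in_diff:
  assumes "recursive_in n F" "recursive_in n G"
  shows "recursive_in n (\<lambda>A xs. F A xs - G A xs)"
proof -
  have "rec_nat a (\<lambda>_ r. r - Suc 0) b = a - b" for a b :: nat by (induction b) auto
  moreover have "recursive_in n (\<lambda>A xs. rec_nat (F A xs) (\<lambda>_ r. r - Suc 0) (G A xs))"
    by (intro recursive_in_rec_nat recursive_in_pred recursive_in_vars assms) auto
  ultimately show ?thesis by simp
qed

lemma recursive_in_sum:
  assumes "recursive_in (Suc n) (\<lambda>A zs. F A (tl zs) (hd zs))" "recursive_in n N"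
  shows "recursive_in n (\<lambda>A xs. \<Sum>k<N A xs. F A xs k)"
proof -
  have eq: "(\<Sum>k<b. h k) = rec_nat 0 (\<lambda>k r. r + h k) b" for h :: "nat \<Rightarrow> nat" and b
    by (induction b) auto
  have "recursive_in (Suc (Suc n)) (\<lambda>A zs. F A (tl (tl zs)) (hd zs))"
  proof -
    have "recursive_in (Suc (Suc n)) (\<lambda>A zs. (hd zs # tl (tl zs)) ! i)" if "i < Suc n" for i
      using that by (cases i) (auto intro: recursive_in_vars)
    from recursive_in_compose[OF assms(1) _ this] show ?thesis by simp
  qed
  then show ?thesis unfolding eq
    by (intro recursive_in_rec_nat recursive_in_add recursive_in_const recursive_in_vars assms) auto
qed

lemma recursive_in_mult:
  assumes "recursive_in n F" "recursive_in n G"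
  shows "recursive_in n (\<lambda>A xs. F A xs * G A xs)"
proof -
  have "recursive_in 2 (\<lambda>A xs. \<Sum>k<hd xs. hd (tl xs))"
    by (intro recursive_in_sum recursive_in_vars) auto
  moreover have "recursive_in n (\<lambda>A xs. [F A xs, G A xs] ! i)" if "i < 2" for i
    using that assms by (cases i) auto
  ultimately have "recursive_in n (\<lambda>A xs. \<Sum>k<F A xs. G A xs)"
    using recursive_in_compose[where L = "\<lambda>A xs. [F A xs, G A xs]" and n = n and m = 2] by force
  then show ?thesis by simp
qed

lemma recursive_in_power2: "recursive_in n F \<Longrightarrow> recursive_in n (\<lambda>A xs. 2 ^ F A xs)"
proof -
  assume F: "recursive_in n F"
  have eq: "2 ^ a = rec_nat (1::nat) (\<lambda>_ r. r + r) a" for a :: nat by (induction a) auto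
  show ?thesis unfolding eq
    by (intro recursive_in_rec_nat recursive_in_add recursive_in_const recursive_in_vars F) auto
qed

lemma recursive_in_of_bool: "decidable_in n P \<Longrightarrow> recursive_in n (\<lambda>A xs. of_bool (P A xs))"
  by (simp add: decidable_in_def)

lemma decidable_in_not: "decidable_in n P \<Longrightarrow> decidable_in n (\<lambda>A xs. \<not> P A xs)"
proof -
  assume P: "decidable_in n P"
  have eq: "of_bool (\<not> b) = 1 - (of_bool b :: nat)" for b by auto
  show ?thesis unfolding decidable_in_def eq
    by (intro recursive_in_diff recursive_in_const recursive_in_of_bool P)
qed

lemma decidable_in_conj:
  "decidable_in n P \<Longrightarrow> decidable_in n Q \<Longrightarrow> decidable_in n (\<lambda>A xs. P A xs \<and> Q A xs)"
  unfolding decidable_in_def of_bool_conj by (rule recursive_in_mult)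

lemma decidable_in_le:
  assumes "recursive_in n F" "recursive_in n G"
  shows "decidable_in n (\<lambda>A xs. F A xs \<le> G A xs)"
proof -
  have eq: "of_bool (a \<le> b) = 1 - (a - b)" for a b :: nat by auto
  show ?thesis unfolding decidable_in_def eq
    by (intro recursive_in_diff recursive_in_const assms)
qed

lemma decidable_in_eq:
  assumes "recursive_in n F" "recursive_in n G"
  shows "decidable_in n (\<lambda>A xs. F A xs = G A xs)"
  unfolding order.eq_iff by (intro decidable_in_conj decidable_in_le assms)

lemma decidable_in_all_less:
  assumes "decidable_in (Suc n) (\<lambda>A zs. P A (tl zs) (hd zs))" "recursive_in n N"
  shows "decidable_in n (\<lambda>A xs. \<forall>k<N A xs. P A xs k)"
proof -
  have eq: "(\<forall>k<b. h k) \<longleftrightarrow> (\<Sum>k<b. of_bool (\<not> h k)) = (0::nat)" for h and b :: nat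
    by auto
  show ?thesis unfolding eq
    by (intro decidable_in_eq recursive_in_sum recursive_in_const recursive_in_of_bool
        decidable_in_not assms)
qed

lemma recursive_in_if:
  assumes "decidable_in n P" "recursive_in n F" "recursive_in n G"
  shows "recursive_in n (\<lambda>A xs. if P A xs then F A xs else G A xs)"
proof -
  have eq: "(if b then x else y) = of_bool b * x + of_bool (\<not> b) * (y::nat)" for b x y by auto
  show ?thesis unfolding eq
    by (intro recursive_in_add recursive_in_mult recursive_in_of_bool decidable_in_not assms)
qed

lemmas recursive_in_intros =
  recursive_in_vars recursive_in_const recursive_in_Suc recursive_in_add recursive_in_diff
  recursive_in_mult recursive_in_power2 recursive_in_sum recursive_in_if recursive_in_of_bool
  decidable_in_not decidable_in_conj decidable_in_le decidable_in_eq decidable_in_all_less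
  decidable_in_oracle

section \<open>Halving and pairing\<close>

lemma recursive_in_div2: "recursive_in n F \<Longrightarrow> recursive_in n (\<lambda>A xs. F A xs div 2)"
proof (rule recursive_in_unary[where h = "\<lambda>A x. x div 2"])
  \<comment> \<open>The bounded sum counts the positive multiples of 2 up to
    \<open>x\<close>.\<close>
  have eq: "x div 2 = (\<Sum>k<x. of_bool (2 * Suc k \<le> x))" for x :: nat
  proof -
    have "{..<x} \<inter> {k. 2 * Suc k \<le> x} = {..<x div 2}" by auto
    then show ?thesis by (simp add: of_bool_def sum.If_cases)
  qed
  show "recursive_in 1 (\<lambda>A xs. hd xs div 2)"
    unfolding eq by (intro recursive_in_intros) auto
qed

lemma recursive_in_prod_encode:
  assumes "recursive_in n F" "recursive_in n G"
  shows "recursive_in n (\<lambda>A xs. prod_encode (F A xs, G A xs))"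
  unfolding prod_encode_def triangle_def split
  by (intro recursive_in_intros recursive_in_div2 assms)

lemma fst_prod_decode_le: "fst (prod_decode w) \<le> w"
  using le_prod_encode_1[of "fst (prod_decode w)" "snd (prod_decode w)"] by simp

lemma snd_prod_decode_le: "snd (prod_decode w) \<le> w"
  using le_prod_encode_2[of "snd (prod_decode w)" "fst (prod_decode w)"] by simp

lemma prod_encode_eq_iff: "prod_encode (a, b) = w \<longleftrightarrow> a = fst (prod_decode w) \<and> b = snd (prod_decode w)"
  by (auto simp: prod_eq_iff[symmetric])

lemma sum_mult_of_bool_eq: "c < n \<Longrightarrow> (\<Sum>k<n. k * of_bool (c = k)) = (c :: nat)"
proof -
  assume "c < n"
  have "(\<Sum>k<n. k * of_bool (c = k)) = (\<Sum>k<n. if c = k then k else 0)"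
    by (rule sum.cong) auto
  then show ?thesis using \<open>c < n\<close> by simp
qed

text \<open>Bounded search written as a sum: both components are at most \<open>w\<close> and only
  one \<open>a\<close> fits, so weighting each \<open>a\<close> by its indicator returns it.\<close>

lemma recursive_in_fst_prod_decode:
  "recursive_in n F \<Longrightarrow> recursive_in n (\<lambda>A xs. fst (prod_decode (F A xs)))"
proof (rule recursive_in_unary[where h = "\<lambda>A w. fst (prod_decode w)"])
  have "(\<exists>b\<le>w. prod_encode (a, b) = w) \<longleftrightarrow> fst (prod_decode w) = a" for a w
    using snd_prod_decode_le[of w] by (metis prod_encode_eq_iff)
  then have eq: "fst (prod_decode w)
      = (\<Sum>a<Suc w. a * of_bool (\<not> (\<forall>b<Suc w. \<not> prod_encode (a, b) = w)))" for w
    using sum_mult_of_bool_eq[of "fst (prod_decode w)" "Suc w"] fst_prod_decode_le[of w]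
    by (simp add: less_Suc_eq_le del: sum.lessThan_Suc)
  show "recursive_in 1 (\<lambda>A xs. fst (prod_decode (hd xs)))"
    unfolding eq by (intro recursive_in_intros recursive_in_prod_encode) auto
qed

lemma recursive_in_snd_prod_decode:
  "recursive_in n F \<Longrightarrow> recursive_in n (\<lambda>A xs. snd (prod_decode (F A xs)))"
proof (rule recursive_in_unary[where h = "\<lambda>A w. snd (prod_decode w)"])
  have "(\<exists>a\<le>w. prod_encode (a, b) = w) \<longleftrightarrow> snd (prod_decode w) = b" for b w
    using fst_prod_decode_le[of w] by (metis prod_encode_eq_iff)
  then have eq: "snd (prod_decode w)
      = (\<Sum>b<Suc w. b * of_bool (\<not> (\<forall>a<Suc w. \<not> prod_encode (a, b) = w)))" for w
    using sum_mult_of_bool_eq[of "snd (prod_decode w)" "Suc w"] snd_prod_decode_le[of w]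
    by (simp add: less_Suc_eq_le del: sum.lessThan_Suc)
  show "recursive_in 1 (\<lambda>A xs. snd (prod_decode (hd xs)))"
    unfolding eq by (intro recursive_in_intros recursive_in_prod_encode) auto
qed

section \<open>Evaluation with bounded search\<close>

text \<open>The bound \<open>t\<close> only limits the search of \<open>Mu\<close>; the result is \<open>Suc y\<close> for the value \<open>y\<close>
  and \<open>0\<close> if there is none yet.\<close>

fun fuel :: "rf \<Rightarrow> (nat \<Rightarrow> bool) \<Rightarrow> nat \<Rightarrow> nat list \<Rightarrow> nat" where
  "fuel Zero A t xs = 1"
| "fuel Succ A t xs = (if xs = [] then 0 else Suc (Suc (hd xs)))"
| "fuel (Proj i) A t xs = (if i < length xs then Suc (xs ! i) else 0)"
| "fuel (Comp f gs) A t xs = (if \<forall>g\<in>set gs. fuel g A t xs \<noteq> 0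
     then fuel f A t (map (\<lambda>g. fuel g A t xs - 1) gs) else 0)"
| "fuel (Prec f g) A t xs = (if xs = [] then 0 else rec_nat (fuel f A t (tl xs))
     (\<lambda>k r. if r = 0 then 0 else fuel g A t (k # (r - 1) # tl xs)) (hd xs))"
| "fuel (Mu f) A t xs = (\<Sum>n<t. Suc n * of_bool (fuel f A t (n # xs) = 1
     \<and> (\<forall>m<n. 2 \<le> fuel f A t (m # xs))))"
| "fuel Orc A t xs = (if xs = [] then 0 else Suc (of_bool (A (hd xs))))"

lemma fuel_Prec_0: "fuel (Prec f g) A t (0 # ys) = fuel f A t ys"
  by simp

lemma fuel_Prec_Suc:
  "fuel (Prec f g) A t (Suc n # ys) = (if fuel (Prec f g) A t (n # ys) = 0 then 0
     else fuel g A t (n # (fuel (Prec f g) A t (n # ys) - 1) # ys))"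
  by (simp cong: if_cong)

text \<open>At most one summand is nonzero, so the sum is a bounded search in which 0 means failure.
  This is why \<open>fuel\<close> treats \<open>Mu\<close> by a sum, which is visibly
  recursive.\<close>

lemma sum_Suc_of_bool_eq_Suc_iff:
  assumes "\<And>m n. P m \<Longrightarrow> P n \<Longrightarrow> m = n"
  shows "(\<Sum>n<t. Suc n * of_bool (P n)) = Suc y \<longleftrightarrow> y < t \<and> P y"
proof (cases "\<exists>n<t. P n")
  case True
  then obtain n where n: "n < t" "P n" by blast
  have "(\<Sum>k<t. Suc k * of_bool (P k)) = (\<Sum>k<t. if k = n then Suc k else 0)"
    using assms n by (intro sum.cong) auto
  then show ?thesis using n assms by auto
qed auto

lemma fuel_Mu_eq_Suc_iff:
  "fuel (Mu f) A t xs = Suc n \<longleftrightarrow>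
     n < t \<and> fuel f A t (n # xs) = 1 \<and> (\<forall>m<n. 2 \<le> fuel f A t (m # xs))"
  unfolding fuel.simps
proof (rule sum_Suc_of_bool_eq_Suc_iff)
  fix m n
  let ?P = "\<lambda>n. fuel f A t (n # xs) = 1 \<and> (\<forall>m<n. 2 \<le> fuel f A t (m # xs))"
  assume "?P m" "?P n"
  then have "\<not> m < n" "\<not> n < m" by force+
  then show "m = n" by simp
qed

text \<open>Only failures can be revised by more fuel. In the case \<open>Mu\<close>, the arguments
  below \<open>y\<close> already have nonzero values at stage \<open>t\<close>, so no smaller root
  can show up later.\<close>

lemma fuel_mono:
  "fuel M A t xs = Suc y \<Longrightarrow> t \<le> u \<Longrightarrow> fuel M A u xs = Suc y"
proof (induction M arbitrary: xs y)
  case (Comp f gs)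
  have pos: "\<forall>g\<in>set gs. fuel g A t xs \<noteq> 0" and
    f: "fuel f A t (map (\<lambda>g. fuel g A t xs - 1) gs) = Suc y"
    using Comp.prems(1) by (auto split: if_splits)
  have "\<forall>g\<in>set gs. fuel g A u xs = fuel g A t xs"
    using pos Comp.IH(2) Comp.prems(2) by (metis not0_implies_Suc)
  then show ?case using pos Comp.IH(1)[OF f Comp.prems(2)] by (simp cong: map_cong)
next
  case (Prec f g)
  then obtain n ys where xs: "xs = n # ys" by (cases xs) auto
  have "fuel (Prec f g) A t (n # ys) = Suc y \<Longrightarrow> fuel (Prec f g) A u (n # ys) = Suc y" for n y
  proof (induction n arbitrary: y)
    case 0
    then show ?case using Prec.IH(1) Prec.prems(2) by (simp only: fuel_Prec_0)
  next
    case (Suc n)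
    obtain r where r: "fuel (Prec f g) A t (n # ys) = Suc r"
      using Suc.prems unfolding fuel_Prec_Suc by (cases "fuel (Prec f g) A t (n # ys)") auto
    then show ?case using Suc.IH[OF r] Suc.prems Prec.IH(2) Prec.prems(2)
      unfolding fuel_Prec_Suc by (simp del: fuel.simps)
  qed
  then show ?case using Prec.prems xs by blast
next
  case (Mu f)
  then have *: "y < t" "fuel f A t (y # xs) = Suc 0" "\<forall>m<y. 2 \<le> fuel f A t (m # xs)"
    unfolding fuel_Mu_eq_Suc_iff by auto
  have "fuel f A u (m # xs) = fuel f A t (m # xs)" if "m \<le> y" for m
  proof -
    have "fuel f A t (m # xs) \<noteq> 0"
    proof (cases "m = y")
      case False
      then have "2 \<le> fuel f A t (m # xs)" using * that by simp
      then show ?thesis by simp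
    qed (use * in simp)
    then obtain z where "fuel f A t (m # xs) = Suc z" using not0_implies_Suc by blast
    then show ?thesis using Mu.IH Mu.prems(2) by simp
  qed
  then show ?case unfolding fuel_Mu_eq_Suc_iff using * Mu.prems(2) by auto
qed auto

lemma fuel_imp_eval: "fuel M A t xs = Suc y \<Longrightarrow> eval A M xs y"
proof (induction M arbitrary: xs y)
  case (Comp f gs)
  have pos: "\<forall>g\<in>set gs. fuel g A t xs \<noteq> 0" and
    f: "fuel f A t (map (\<lambda>g. fuel g A t xs - 1) gs) = Suc y"
    using Comp.prems(1) by (auto split: if_splits)
  have "\<forall>g\<in>set gs. eval A g xs (fuel g A t xs - 1)"
    using Comp.IH(2) pos by simp
  then show ?case using Comp.IH(1)[OF f]
    by (intro ev_comp[where ys = "map (\<lambda>g. fuel g A t xs - 1) gs"]) auto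
next
  case (Prec f g)
  then obtain n ys where xs: "xs = n # ys" by (cases xs) auto
  have "fuel (Prec f g) A t (n # ys) = Suc y \<Longrightarrow> eval A (Prec f g) (n # ys) y" for n y
  proof (induction n arbitrary: y)
    case 0
    then show ?case using Prec.IH(1) unfolding fuel_Prec_0 by (blast intro: ev_prec0)
  next
    case (Suc n)
    obtain r where r: "fuel (Prec f g) A t (n # ys) = Suc r"
      using Suc.prems unfolding fuel_Prec_Suc by (cases "fuel (Prec f g) A t (n # ys)") auto
    then have "fuel g A t (n # r # ys) = Suc y"
      using Suc.prems unfolding fuel_Prec_Suc by (simp del: fuel.simps)
    then show ?case using Suc.IH[OF r] Prec.IH(2) by (blast intro: ev_precS)
  qed
  then show ?case using Prec.prems xs by blast
next
  case (Mu f)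
  then have *: "fuel f A t (y # xs) = Suc 0" "\<forall>m<y. 2 \<le> fuel f A t (m # xs)"
    unfolding fuel_Mu_eq_Suc_iff by auto
  have "\<exists>k. eval A f (m # xs) (Suc k)" if "m < y" for m
  proof -
    have "2 \<le> fuel f A t (m # xs)" using *(2) that by blast
    then obtain k where "fuel f A t (m # xs) = 2 + k" using le_Suc_ex by blast
    then have "fuel f A t (m # xs) = Suc (Suc k)" by simp
    then show ?thesis using Mu.IH by blast
  qed
  then show ?case using Mu.IH[OF *(1)] by (blast intro: ev_mu)
next
  case Zero
  then show ?case by (auto intro: ev_zero)
next
  case Succ
  then show ?case by (cases xs) (auto intro: ev_succ)
next
  case (Proj i)
  then show ?case by (auto intro: ev_proj split: if_splits)
next
  case Orc
  then obtain n ys where "xs = n # ys" by (cases xs) auto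
  then show ?case using ev_orc[of A n ys] Orc by (auto simp: of_bool_def)
qed

lemma uniform_fuel:
  fixes n :: nat
  assumes "\<forall>i<n. \<exists>t. fuel (M i) A t (xs i) = Suc (y i)"
  shows "\<exists>t. \<forall>i<n. fuel (M i) A t (xs i) = Suc (y i)"
  using assms
proof (induction n)
  case (Suc n)
  then obtain t u where t: "\<forall>i<n. fuel (M i) A t (xs i) = Suc (y i)"
    and u: "fuel (M n) A u (xs n) = Suc (y n)" by auto
  have "fuel (M i) A (max t u) (xs i) = Suc (y i)" if "i < Suc n" for i
  proof (cases "i = n")
    case True
    then show ?thesis using fuel_mono[OF u, of "max t u"] by simp
  next
    case False
    then have "fuel (M i) A t (xs i) = Suc (y i)" using t that by simp
    then show ?thesis using fuel_mono[of "M i" A t "xs i" "y i" "max t u"] by simp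
  qed
  then show ?case by blast
qed simp

lemma eval_imp_fuel: "eval A M xs y \<Longrightarrow> \<exists>t. fuel M A t xs = Suc y"
proof (induction rule: eval.induct)
  case (ev_comp ys gs xs f z)
  obtain u where u: "\<forall>i<length gs. fuel (gs ! i) A u xs = Suc (ys ! i)"
    using ev_comp.IH(1) uniform_fuel[of "length gs" "\<lambda>i. gs ! i" A "\<lambda>_. xs" "\<lambda>i. ys ! i"] by blast
  obtain v where v: "fuel f A v ys = Suc z" using ev_comp.IH(2) by blast
  let ?t = "max u v"
  have "\<forall>i<length gs. fuel (gs ! i) A ?t xs = Suc (ys ! i)"
    using u fuel_mono by (metis max.cobounded1)
  moreover from this have "map (\<lambda>g. fuel g A ?t xs - 1) gs = ys"
    using ev_comp.hyps by (intro nth_equalityI) auto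
  moreover have "fuel f A ?t ys = Suc z" using fuel_mono[OF v, of ?t] by simp
  ultimately have "fuel (Comp f gs) A ?t xs = Suc z" by (auto simp: in_set_conv_nth)
      (metis zero_less_Suc)
  then show ?case by blast
next
  case (ev_precS f g n ys z w)
  then obtain u v where u: "fuel (Prec f g) A u (n # ys) = Suc z"
    and v: "fuel g A v (n # z # ys) = Suc w" by blast
  have "fuel (Prec f g) A (max u v) (n # ys) = Suc z" "fuel g A (max u v) (n # z # ys) = Suc w"
    using fuel_mono[OF u, of "max u v"] fuel_mono[OF v, of "max u v"] by auto
  then have "fuel (Prec f g) A (max u v) (Suc n # ys) = Suc w"
    unfolding fuel_Prec_Suc by (simp del: fuel.simps)
  then show ?case by blast
next
  case (ev_mu f n ys)
  obtain u where u: "fuel f A u (n # ys) = Suc 0" using ev_mu.IH(1) by blast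
  from ev_mu.IH(2) have "\<forall>m<n. \<exists>t k. fuel f A t (m # ys) = Suc (Suc k)" by blast
  then obtain k where "\<forall>m<n. \<exists>t. fuel f A t (m # ys) = Suc (Suc (k m))" by metis
  then obtain v where v: "\<forall>m<n. fuel f A v (m # ys) = Suc (Suc (k m))"
    using uniform_fuel[of n "\<lambda>_. f" A "\<lambda>m. m # ys" "\<lambda>m. Suc (k m)"] by blast
  let ?t = "max (Suc n) (max u v)"
  have "fuel f A ?t (n # ys) = Suc 0" using fuel_mono[OF u, of ?t] by simp
  moreover have "\<forall>m<n. fuel f A ?t (m # ys) = Suc (Suc (k m))"
    using v fuel_mono[of f A v _ _ ?t] by simp
  ultimately have "fuel (Mu f) A ?t ys = Suc n" unfolding fuel_Mu_eq_Suc_iff by simp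
  then show ?case by blast
qed auto

lemma eval_iff_fuel: "eval A M xs y \<longleftrightarrow> (\<exists>t. fuel M A t xs = Suc y)"
  using eval_imp_fuel fuel_imp_eval by blast

text \<open>\<open>M\<close> is fixed outside the computation, so induction on its structure
  replaces an interpreter. \<open>B\<close> allows a machine to simulate \<open>M\<close> either
  with its own oracle or with \<open>no_oracle\<close>.\<close>

lemma recursive_in_fuel_list:
  assumes "\<And>n F. recursive_in n F \<Longrightarrow> decidable_in n (\<lambda>A xs. B A (F A xs))"
  shows "recursive_in (Suc n) (\<lambda>A zs. fuel M (B A) (hd zs) (tl zs))"
proof (induction M arbitrary: n)
  case Zero
  show ?case by (simp add: recursive_in_const)
next
  case Succ
  show ?case
  proof (cases n)
    case 0
    then show ?thesis
      by (subst recursive_in_cong[where G = "\<lambda>_ _. 0"]) (auto simp: recursive_in_const length_Suc_conv)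
  next
    case (Suc m)
    then show ?thesis
      by (subst recursive_in_cong[where G = "\<lambda>_ zs. Suc (Suc (hd (tl zs)))"])
        (auto simp: length_Suc_conv intro!: recursive_in_intros)
  qed
next
  case (Proj i)
  show ?case
  proof (cases "i < n")
    case True
    then show ?thesis
      by (subst recursive_in_cong[where G = "\<lambda>_ zs. Suc (tl zs ! i)"])
        (auto intro!: recursive_in_intros)
  next
    case False
    then show ?thesis
      by (subst recursive_in_cong[where G = "\<lambda>_ zs. 0"]) (auto intro!: recursive_in_const)
  qed
next
  case (Comp f gs)
  have "decidable_in (Suc n) (\<lambda>A zs. \<forall>g\<in>set gs'. fuel g (B A) (hd zs) (tl zs) \<noteq> 0)"
    if "set gs' \<subseteq> set gs" for gs'
    using that
  proof (induction gs')
    case Nil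
    show ?case by (simp add: decidable_in_def recursive_in_const)
  next
    case (Cons g gs')
    then show ?case unfolding list.set ball_simps
      by (intro decidable_in_conj decidable_in_not decidable_in_eq recursive_in_const Comp.IH(2)) auto
  qed
  moreover have "recursive_in (Suc n)
      (\<lambda>A zs. (hd zs # map (\<lambda>g. fuel g (B A) (hd zs) (tl zs) - 1) gs) ! i)"
    if "i < Suc (length gs)" for i
    using that by (cases i) (auto intro!: recursive_in_intros Comp.IH(2))
  from recursive_in_compose[OF Comp.IH(1) _ this]
  have "recursive_in (Suc n)
      (\<lambda>A zs. fuel f (B A) (hd zs) (map (\<lambda>g. fuel g (B A) (hd zs) (tl zs) - 1) gs))"
    by simp
  ultimately show ?case unfolding fuel.simps by (intro recursive_in_intros) auto
next
  case (Prec f g)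
  show ?case
  proof (cases n)
    case 0
    then show ?thesis
      by (subst recursive_in_cong[where G = "\<lambda>_ _. 0"]) (auto simp: recursive_in_const length_Suc_conv)
  next
    case (Suc m)
    have "recursive_in (Suc n) (\<lambda>A zs. (hd zs # tl (tl zs)) ! i)" if "i < Suc m" for i
      using that Suc by (cases i) (auto intro!: recursive_in_vars)
    from recursive_in_compose[OF Prec.IH(1) _ this]
    have f: "recursive_in (Suc n) (\<lambda>A zs. fuel f (B A) (hd zs) (tl (tl zs)))" using Suc by simp
    have "recursive_in (Suc (Suc (Suc n)))
        (\<lambda>A zs. (hd (tl (tl zs)) # hd zs # (hd (tl zs) - 1) # tl (tl (tl (tl zs)))) ! i)"
      if i: "i < Suc (Suc (Suc m))" for i
    proof -
      consider "i = 0" | "i = 1" | "i = 2" | j where "i = Suc (Suc (Suc j))" "j < m"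
        using i by (auto simp: less_Suc_eq_0_disj numeral_2_eq_2)
      then show ?thesis
      proof cases
        case 4
        then show ?thesis using Suc
          by (subst recursive_in_cong[where G = "\<lambda>_ zs. zs ! Suc (Suc (Suc (Suc j)))"])
            (auto simp: nth_tl intro!: recursive_in_vars)
      qed (auto simp: numeral_2_eq_2 intro!: recursive_in_intros)
    qed
    from recursive_in_compose[OF Prec.IH(2) _ this]
    have g: "recursive_in (Suc (Suc (Suc n))) (\<lambda>A zs. fuel g (B A) (hd (tl (tl zs)))
        (hd zs # (hd (tl zs) - 1) # tl (tl (tl (tl zs)))))" using Suc by simp
    have "recursive_in (Suc n) (\<lambda>A zs. rec_nat (fuel f (B A) (hd zs) (tl (tl zs)))
       (\<lambda>k r. if r = 0 then 0 else fuel g (B A) (hd zs) (k # (r - 1) # tl (tl zs))) (hd (tl zs)))"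
      by (intro recursive_in_rec_nat recursive_in_intros f g) (use Suc in auto)
    then show ?thesis
      by (subst (asm) recursive_in_cong[where G = "\<lambda>A zs. fuel (Prec f g) (B A) (hd zs) (tl zs)"])
        (use Suc in \<open>auto simp: length_Suc_conv\<close>)
  qed
next
  case (Mu f)
  have "recursive_in (Suc (Suc n)) (\<lambda>A zs. (hd (tl zs) # hd zs # tl (tl zs)) ! i)"
    if i: "i < Suc (Suc n)" for i
  proof -
    consider "i = 0" | "i = 1" | j where "i = Suc (Suc j)" "j < n"
      using i by (auto simp: less_Suc_eq_0_disj)
    then show ?thesis by cases (auto intro!: recursive_in_vars)
  qed
  from recursive_in_compose[OF Mu _ this]
  have 1: "recursive_in (Suc (Suc n)) (\<lambda>A zs. fuel f (B A) (hd (tl zs)) (hd zs # tl (tl zs)))" by simp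
  have "recursive_in (Suc (Suc (Suc n))) (\<lambda>A zs. (hd (tl (tl zs)) # hd zs # tl (tl (tl zs))) ! i)"
    if i: "i < Suc (Suc n)" for i
  proof -
    consider "i = 0" | "i = 1" | j where "i = Suc (Suc j)" "j < n"
      using i by (auto simp: less_Suc_eq_0_disj)
    then show ?thesis by cases (auto intro!: recursive_in_vars)
  qed
  from recursive_in_compose[OF Mu _ this]
  have 2: "recursive_in (Suc (Suc (Suc n)))
      (\<lambda>A zs. fuel f (B A) (hd (tl (tl zs))) (hd zs # tl (tl (tl zs))))" by simp
  show ?case unfolding fuel.simps by (intro recursive_in_intros 1 2) auto
next
  case Orc
  show ?case
  proof (cases n)
    case 0
    then show ?thesis
      by (subst recursive_in_cong[where G = "\<lambda>_ _. 0"]) (auto simp: recursive_in_const length_Suc_conv)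
  next
    case (Suc m)
    then show ?thesis
      by (subst recursive_in_cong[where G = "\<lambda>A zs. Suc (of_bool (B A (hd (tl zs))))"])
        (auto simp: length_Suc_conv intro!: recursive_in_intros assms)
  qed
qed

lemma recursive_in_fuel:
  assumes "\<And>n F. recursive_in n F \<Longrightarrow> decidable_in n (\<lambda>A xs. B A (F A xs))"
    and "recursive_in n T" "recursive_in n F"
  shows "recursive_in n (\<lambda>A xs. fuel M (B A) (T A xs) [F A xs])"
proof -
  have "recursive_in 2 (\<lambda>A zs. fuel M (B A) (hd zs) (tl zs))"
    unfolding numeral_2_eq_2 by (rule recursive_in_fuel_list) (rule assms(1))
  moreover have "recursive_in n (\<lambda>A xs. [T A xs, F A xs] ! i)" if "i < 2" for i
    using that assms(2,3) by (cases i) auto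
  ultimately show ?thesis
    using recursive_in_compose[where L = "\<lambda>A xs. [T A xs, F A xs]" and n = n and m = 2] by force
qed

lemmas recursive_in_fuel_relative = recursive_in_fuel[where B = "\<lambda>A. A", OF decidable_in_oracle]

lemma recursive_in_fuel_no_oracle:
  "recursive_in n T \<Longrightarrow> recursive_in n F \<Longrightarrow> recursive_in n (\<lambda>A xs. fuel M no_oracle (T A xs) [F A xs])"
  by (rule recursive_in_fuel) (simp_all add: no_oracle_def decidable_in_def recursive_in_const)

text \<open>A relativised Kleene normal form: partiality is confined to one \<open>Mu\<close>, so
  that the machines below need only total ingredients.\<close>

lemma exists_search_machine:
  assumes "decidable_in 2 (\<lambda>A zs. P A (hd zs) (hd (tl zs)))" "recursive_in 2 (\<lambda>A zs. G A (hd zs) (hd (tl zs)))"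
  obtains M where "\<And>A x. compute A M [x] =
    (if \<exists>w. P A w x then Some (G A (LEAST w. P A w x) x) else None)"
proof -
  \<comment> \<open>\<open>Mu\<close> looks for a zero, hence the negation.\<close>
  have "recursive_in 2 (\<lambda>A zs. of_bool (\<not> P A (hd zs) (hd (tl zs))))"
    by (intro recursive_in_of_bool decidable_in_not assms)
  then obtain p where p: "\<And>A zs. length zs = 2 \<Longrightarrow> eval A p zs (of_bool (\<not> P A (hd zs) (hd (tl zs))))"
    unfolding recursive_in_def by blast
  then have p': "eval A p [w, x] y \<longleftrightarrow> y = of_bool (\<not> P A w x)" for A w x y
    using p[of "[w, x]" A] eval_deterministic by auto
  obtain g where g: "\<And>A zs. length zs = 2 \<Longrightarrow> eval A g zs (G A (hd zs) (hd (tl zs)))"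
    using assms(2) unfolding recursive_in_def by blast
  have mu: "eval A (Mu p) [x] w \<longleftrightarrow> P A w x \<and> (\<forall>v<w. \<not> P A v x)" for A x w
    by (auto elim!: eval_muE intro!: ev_mu simp: p')
  have "eval A (Comp g [Mu p, Proj 0]) [x] y \<longleftrightarrow>
      (\<exists>w. P A w x) \<and> y = G A (LEAST w. P A w x) x" for A x y
  proof
    assume "eval A (Comp g [Mu p, Proj 0]) [x] y"
    then obtain w where w: "eval A (Mu p) [x] w" "eval A g [w, x] y"
      by (auto elim!: eval_compE simp: length_Suc_conv less_Suc_eq all_conj_distrib)
        (auto elim!: eval_projE)
    from w(1) have "(LEAST w. P A w x) = w"
      unfolding mu by (intro Least_equality) (auto simp: not_less[symmetric])
    moreover have "y = G A w x" using eval_deterministic[OF w(2)] g[of "[w, x]" A] by simp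
    ultimately show "(\<exists>w. P A w x) \<and> y = G A (LEAST w. P A w x) x"
      using w(1) mu by blast
  next
    assume R: "(\<exists>w. P A w x) \<and> y = G A (LEAST w. P A w x) x"
    let ?w = "LEAST w. P A w x"
    have "eval A (Mu p) [x] ?w" using R mu by (meson LeastI not_less_Least)
    moreover have "eval A (Proj 0) [x] x" using ev_proj[of 0 "[x]" A] by simp
    moreover have "eval A g [?w, x] y" using R g[of "[?w, x]" A] by simp
    ultimately show "eval A (Comp g [Mu p, Proj 0]) [x] y"
      by (intro ev_comp[where ys = "[?w, x]"]) (auto simp: less_Suc_eq)
  qed
  then have "compute A (Comp g [Mu p, Proj 0]) [x] =
      (if \<exists>w. P A w x then Some (G A (LEAST w. P A w x) x) else None)" for A x
    by (metis (no_types, lifting) compute_eq_Some_iff not_Some_eq)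
  then show thesis by (rule that)
qed

section \<open>Strings and prefix codes\<close>

declare nat_str.simps [simp del]

lemma nat_str_str_nat [simp]: "nat_str (str_nat s) = s"
  by (induction s) (subst nat_str.simps; auto)+

lemma str_nat_nat_str [simp]: "str_nat (nat_str n) = n"
proof (induction n rule: less_induct)
  case (less n)
  show ?case
  proof (cases "n = 0")
    case True
    then show ?thesis by (subst nat_str.simps) simp
  next
    case False
    then show ?thesis
      using less[of "(n - 1) div 2"] less[of "(n - 2) div 2"]
      by (subst nat_str.simps) (auto elim!: oddE evenE)
  qed
qed

lemma str_nat_append: "str_nat (s @ t) = str_nat s + 2 ^ length s * str_nat t"
  by (induction s) (auto simp: algebra_simps)

text \<open>In binary, \<open>Suc (str_nat s)\<close> is a leading 1 above the bits of
  \<open>s\<close>, the first bit being the lowest. Comparison with powers of two thus reveals the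
  length.\<close>

lemma str_nat_bounds: "2 ^ length s \<le> Suc (str_nat s)" "Suc (str_nat s) < 2 ^ Suc (length s)"
  by (induction s) auto

lemma length_le_str_nat: "length s \<le> str_nat s"
  using str_nat_bounds(1)[of s] less_exp[of "length s"] by linarith

lemma length_nat_str_le: "length (nat_str n) \<le> n"
  using length_le_str_nat[of "nat_str n"] by simp

lemma recursive_in_length_nat_str:
  "recursive_in n F \<Longrightarrow> recursive_in n (\<lambda>A xs. length (nat_str (F A xs)))"
proof (rule recursive_in_unary[where h = "\<lambda>A x. length (nat_str x)"])
  have eq: "length (nat_str x) = (\<Sum>l<x. of_bool (2 ^ Suc l \<le> Suc x))" for x
  proof -
    have "2 ^ Suc l \<le> Suc x \<longleftrightarrow> l < length (nat_str x)" for l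
    proof
      assume "2 ^ Suc l \<le> Suc x"
      then have "(2::nat) ^ Suc l < 2 ^ Suc (length (nat_str x))"
        using str_nat_bounds(2)[of "nat_str x"] unfolding str_nat_nat_str by (rule le_less_trans)
      then show "l < length (nat_str x)" by simp
    next
      assume "l < length (nat_str x)"
      then have "(2::nat) ^ Suc l \<le> 2 ^ length (nat_str x)" by (intro power_increasing) auto
      then show "2 ^ Suc l \<le> Suc x" using str_nat_bounds(1)[of "nat_str x"] by simp
    qed
    then have "(\<Sum>l<x. of_bool (2 ^ Suc l \<le> Suc x)) = card ({..<x} \<inter> {l. l < length (nat_str x)})"
      by (simp add: of_bool_def sum.If_cases)
    also have "{..<x} \<inter> {l. l < length (nat_str x)} = {..<length (nat_str x)}"
      using length_nat_str_le[of x] by auto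
    finally show ?thesis by simp
  qed
  show "recursive_in 1 (\<lambda>A xs. length (nat_str (hd xs)))"
    unfolding eq by (intro recursive_in_intros) auto
qed

text \<open>\<open>str_nat\<close> reads the first bit as the least significant one, whereas extensions of a string
  form an interval only if it is the most significant one.\<close>

definition str_index :: "bool list \<Rightarrow> nat" where
  "str_index s = foldl (\<lambda>a b. 2 * a + of_bool b) 0 s"

lemma str_index_Nil [simp]: "str_index [] = 0"
  by (simp add: str_index_def)

lemma str_index_snoc [simp]: "str_index (s @ [b]) = 2 * str_index s + of_bool b"
  by (simp add: str_index_def)

lemma str_index_append: "str_index (s @ t) = str_index s * 2 ^ length t + str_index t"
proof (induction t rule: rev_induct)
  case (snoc b t)
  then show ?case
    using str_index_snoc[of "s @ t" b] by simp
qed simp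

lemma str_index_less: "str_index s < 2 ^ length s"
  by (induction s rule: rev_induct) auto

lemma ex_str_index: "i < 2 ^ l \<Longrightarrow> \<exists>s. length s = l \<and> str_index s = i"
proof (induction l arbitrary: i)
  case (Suc l)
  then have "i div 2 < 2 ^ l" by simp
  then obtain s where "length s = l" "str_index s = i div 2" using Suc.IH by blast
  then have "length (s @ [odd i]) = Suc l \<and> str_index (s @ [odd i]) = i" by simp
  then show ?case by blast
qed simp

lemma recursive_in_str_index:
  "recursive_in n F \<Longrightarrow> recursive_in n (\<lambda>A xs. str_index (nat_str (F A xs)))"
proof (rule recursive_in_unary[where h = "\<lambda>A x. str_index (nat_str x)"])
  define dropn where "dropn x i = rec_nat x (\<lambda>_ r. (r - Suc 0) div 2) i" for x i :: nat
  have dropn: "dropn (str_nat s) i = str_nat (drop i s)" for s i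
  proof (induction i)
    case (Suc i)
    have "(str_nat t - Suc 0) div 2 = str_nat (tl t)" for t by (cases t) auto
    then show ?case using Suc by (simp add: dropn_def drop_Suc tl_drop)
  qed (simp add: dropn_def)
  \<comment> \<open>A nonempty string starts with \<open>True\<close> exactly if its code is even.
    The empty string also has an even code, but it does not occur below the length.\<close>
  have "rec_nat 0 (\<lambda>i r. 2 * r + of_bool (dropn (str_nat s) i = 2 * (dropn (str_nat s) i div 2))) i
      = str_index (take i s)" if "i \<le> length s" for s i
    using that
  proof (induction i)
    case (Suc i)
    then have "drop i s = s ! i # drop (Suc i) s" by (simp add: Cons_nth_drop_Suc)
    then have "dropn (str_nat s) i = 2 * (dropn (str_nat s) i div 2) \<longleftrightarrow> s ! i"
      unfolding dropn by simp
    then show ?case using Suc by (simp add: take_Suc_conv_app_nth)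
  qed simp
  from this[of "length (nat_str x)" "nat_str x" for x]
  have eq: "str_index (nat_str x) = rec_nat 0
      (\<lambda>i r. 2 * r + of_bool (dropn x i = 2 * (dropn x i div 2))) (length (nat_str x))" for x
    by simp
  have rec_dropn: "recursive_in n F \<Longrightarrow> recursive_in n G
      \<Longrightarrow> recursive_in n (\<lambda>A xs. dropn (F A xs) (G A xs))"
    for n F G
    unfolding dropn_def
    by (intro recursive_in_rec_nat recursive_in_div2 recursive_in_intros) auto
  show "recursive_in 1 (\<lambda>A xs. str_index (nat_str (hd xs)))"
    unfolding eq
    by (intro recursive_in_rec_nat recursive_in_div2 recursive_in_intros recursive_in_length_nat_str
        rec_dropn) auto
qed

section \<open>Kraft's inequality and interval codes\<close>

lemma kraft_inequality:
  fixes P :: "bool list set"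
  assumes "finite P" "\<And>p q. p \<in> P \<Longrightarrow> q \<in> P \<Longrightarrow> prefix p q \<Longrightarrow> p = q"
  shows "(\<Sum>p\<in>P. (1/2::real) ^ length p) \<le> 1"
proof -
  define N where "N = Max (insert 0 (length ` P))"
  \<comment> \<open>The extensions of \<open>p\<close> to the common length \<open>N\<close>:
    incomparable strings have disjoint sets of extensions, and there are only \<open>2 ^ N\<close>
    strings to share.\<close>
  define C where "C p = (\<lambda>z. p @ z) ` {z :: bool list. length z = N - length p}" for p :: "bool list"
  have len: "length p \<le> N" if "p \<in> P" for p
    using that assms(1) unfolding N_def by (intro Max_ge) auto
  have all: "card {z :: bool list. length z = n} = 2 ^ n" "finite {z :: bool list. length z = n}" for n
    using card_lists_length_eq[of "UNIV :: bool set" n] finite_lists_length_eq[of "UNIV :: bool set" n]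
    by auto
  have card: "card (C p) = 2 ^ (N - length p)" for p
    unfolding C_def by (subst card_image) (auto simp: inj_on_def all)
  have disj: "C p \<inter> C q = {}" if "p \<in> P" "q \<in> P" "p \<noteq> q" for p q
  proof (rule ccontr)
    assume "C p \<inter> C q \<noteq> {}"
    then obtain y z where "p @ y = q @ z" unfolding C_def by auto
    then have "prefix q (p @ y)" by simp
    moreover have "prefix p (p @ y)" by simp
    ultimately have "prefix p q \<or> prefix q p" using prefix_same_cases by blast
    then show False using assms(2) that by blast
  qed
  have "(\<Sum>p\<in>P. card (C p)) = card (\<Union>p\<in>P. C p)"
    using assms(1) disj by (subst card_UN_disjoint) (auto simp: C_def all)
  also have "\<dots> \<le> card {z :: bool list. length z = N}"
    using len by (intro card_mono all) (auto simp: C_def)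
  finally have "(\<Sum>p\<in>P. (2::nat) ^ (N - length p)) \<le> 2 ^ N" by (simp add: card all)
  then have "real (\<Sum>p\<in>P. 2 ^ (N - length p)) \<le> real (2 ^ N)" by (rule of_nat_mono)
  then have "(\<Sum>p\<in>P. (2::real) ^ (N - length p)) / 2 ^ N \<le> 1" by simp
  also have "(\<Sum>p\<in>P. (2::real) ^ (N - length p)) / 2 ^ N = (\<Sum>p\<in>P. (1/2::real) ^ length p)"
    unfolding sum_divide_distrib
    using len by (intro sum.cong refl) (simp add: power_diff power_one_over field_simps)
  finally show ?thesis .
qed

text \<open>A computable form of the Kraft--Chaitin allocation. The request \<open>e\<close> (valid if \<open>V e\<close>)
  receives the half-open interval of length \<open>2 ^ -(l e)\<close> that starts where the intervals of
  the earlier requests end. It contains a dyadic interval of half its length, whose string is a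
  codeword for \<open>e\<close>. Codewords of different requests are incomparable whatever \<open>V\<close> and
  \<open>l\<close> are, because intervals that run beyond 1 have no codewords.\<close>

definition code_start :: "(nat \<Rightarrow> bool) \<Rightarrow> (nat \<Rightarrow> nat) \<Rightarrow> nat \<Rightarrow> real" where
  "code_start V l e = (\<Sum>i\<in>{i. i < e \<and> V i}. (1/2) ^ l i)"

definition is_codeword :: "(nat \<Rightarrow> bool) \<Rightarrow> (nat \<Rightarrow> nat) \<Rightarrow> nat \<Rightarrow> bool list \<Rightarrow> bool" where
  "is_codeword V l e r \<longleftrightarrow> V e \<and> length r = Suc (l e) \<and>
     code_start V l e \<le> real (str_index r) / 2 ^ length r \<and>
     (real (str_index r) + 1) / 2 ^ length r \<le> code_start V l e + (1/2) ^ l e"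

lemma code_start_add: "V e \<Longrightarrow> code_start V l e + (1/2) ^ l e = (\<Sum>i\<in>{i. i \<le> e \<and> V i}. (1/2) ^ l i)"
proof -
  assume "V e"
  then have "{i. i \<le> e \<and> V i} = insert e {i. i < e \<and> V i}" by auto
  then show ?thesis by (simp add: code_start_def)
qed

lemma code_start_mono: "V e \<Longrightarrow> e < f \<Longrightarrow> code_start V l e + (1/2) ^ l e \<le> code_start V l f"
  unfolding code_start_add unfolding code_start_def by (rule sum_mono2) auto

text \<open>A prefix means containment of dyadic intervals (\<open>lo\<close>, \<open>hi\<close>),
  which are not degenerate (\<open>lt\<close>). The intervals of distinct requests do not overlap,
  so the requests agree, and then equal lengths force equal strings.\<close>

lemma is_codeword_prefix_free:
  assumes "is_codeword V l e r" "is_codeword V l f s" "prefix r s"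
  shows "e = f \<and> r = s"
proof -
  obtain z where s: "s = r @ z" using assms(3) by (auto simp: prefix_def)
  have "real (str_index r) / 2 ^ length r = real (str_index r * 2 ^ length z) / 2 ^ length s"
    by (simp add: s power_add)
  also have "\<dots> \<le> real (str_index s) / 2 ^ length s"
    unfolding s str_index_append by (intro divide_right_mono) auto
  finally have lo: "real (str_index r) / 2 ^ length r \<le> real (str_index s) / 2 ^ length s" .
  have "str_index s + 1 \<le> (str_index r + 1) * 2 ^ length z"
    using str_index_less[of z] by (simp add: s str_index_append)
  then have "real (str_index s + 1) \<le> real ((str_index r + 1) * 2 ^ length z)" by (rule of_nat_mono)
  then have "(real (str_index s) + 1) / 2 ^ length s
      \<le> (real (str_index r) + 1) * 2 ^ length z / 2 ^ length s"
    by (intro divide_right_mono) (auto simp: algebra_simps)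
  also have "\<dots> = (real (str_index r) + 1) / 2 ^ length r"
    by (simp add: s power_add)
  finally have hi: "(real (str_index s) + 1) / 2 ^ length s \<le> (real (str_index r) + 1) / 2 ^ length r" .
  have lt: "real (str_index s) / 2 ^ length s < (real (str_index s) + 1) / 2 ^ length s"
    by (simp add: divide_strict_right_mono)
  have "\<not> e < f"
    using assms(1,2) code_start_mono[of V e f l] lo hi lt unfolding is_codeword_def by linarith
  moreover have "\<not> f < e"
    using assms(1,2) code_start_mono[of V f e l] lo hi lt unfolding is_codeword_def by linarith
  ultimately have "e = f" by simp
  then show ?thesis using assms s unfolding is_codeword_def by simp
qed

lemma ex_codeword:
  assumes "V e" "\<And>E. finite E \<Longrightarrow> \<forall>i\<in>E. V i \<Longrightarrow> (\<Sum>i\<in>E. (1/2::real) ^ l i) \<le> 1"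
  obtains r where "is_codeword V l e r"
proof -
  let ?s = "code_start V l e" and ?N = "2 ^ Suc (l e) :: real"
  \<comment> \<open>Rounding the left end up to the grid of mesh \<open>1 / ?N\<close> costs less
    than one grid step, and the interval is two steps long. Hence the extra bit in
    \<open>is_codeword\<close>.\<close>
  define i where "i = nat \<lceil>?s * ?N\<rceil>"
  have "0 \<le> ?s" unfolding code_start_def by (intro sum_nonneg) auto
  then have i: "?s * ?N \<le> real i" "real i < ?s * ?N + 1"
    unfolding i_def by (auto simp: of_nat_ceiling) linarith
  have "?s + (1/2) ^ l e \<le> 1"
    unfolding code_start_add[of V, OF assms(1)] by (rule assms(2)) auto
  then have "(?s + (1/2) ^ l e) * ?N \<le> ?N" by (simp add: mult_le_cancel_right1)
  moreover have stop: "(?s + (1/2) ^ l e) * ?N = ?s * ?N + 2"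
    by (simp add: algebra_simps power_one_over)
  ultimately have "real i < 2 ^ Suc (l e)" using i(2) by linarith
  then have "i < 2 ^ Suc (l e)" by (metis of_nat_less_numeral_power_cancel_iff)
  then obtain r where r: "length r = Suc (l e)" "str_index r = i" using ex_str_index by blast
  have "real i + 1 \<le> (?s + (1/2) ^ l e) * ?N" using stop i(2) by linarith
  then have "is_codeword V l e r"
    unfolding is_codeword_def using assms(1) i(1) r by (simp add: le_divide_eq divide_le_eq)
  then show thesis by (rule that)
qed

text \<open>Scaling by powers of two replaces the real inequalities by natural ones. The bound
  \<open>le\<close> makes \<open>2 ^ Suc e\<close> a common denominator for all requests before
  \<open>e\<close>. The list \<open>xs\<close> carries parameters on which the code may
  depend.\<close>

lemma decidable_in_is_codeword:
  assumes V: "decidable_in (Suc n) (\<lambda>A zs. V A (tl zs) (hd zs))"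
    and l: "recursive_in (Suc n) (\<lambda>A zs. l A (tl zs) (hd zs))"
    and le: "\<And>A xs e. l A xs e \<le> Suc e"
  shows "decidable_in (Suc (Suc n))
    (\<lambda>A zs. is_codeword (V A (tl (tl zs))) (l A (tl (tl zs))) (hd zs) (nat_str (hd (tl zs))))"
proof -
  define S :: "(nat \<Rightarrow> bool) \<Rightarrow> nat list \<Rightarrow> nat \<Rightarrow> nat"
    where "S A xs e = (\<Sum>i<e. of_bool (V A xs i) * 2 ^ (Suc e - l A xs i))"
    for A xs and e :: nat
  have S: "code_start (V A xs) (l A xs) e = real (S A xs e) / 2 ^ Suc e" for A xs e
  proof -
    have "real (S A xs e) / 2 ^ Suc e
        = (\<Sum>i<e. of_bool (V A xs i) * 2 ^ (Suc e - l A xs i) / 2 ^ Suc e)"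
      unfolding S_def of_nat_sum sum_divide_distrib by (intro sum.cong) auto
    also have "\<dots> = (\<Sum>i<e. if V A xs i then (1/2) ^ l A xs i else 0)"
    proof (intro sum.cong refl)
      fix i assume "i \<in> {..<e}"
      then have "l A xs i \<le> Suc e" using le[of A xs i] by simp
      then have "(2::real) ^ (Suc e - l A xs i) / 2 ^ Suc e = (1/2) ^ l A xs i"
        by (simp add: power_diff power_one_over field_simps del: power_Suc)
      then show "of_bool (V A xs i) * 2 ^ (Suc e - l A xs i) / 2 ^ Suc e
          = (if V A xs i then (1/2) ^ l A xs i else (0::real))" by simp
    qed
    also have "\<dots> = code_start (V A xs) (l A xs) e"
      unfolding code_start_def by (subst sum.inter_filter[symmetric]) (auto simp: lessThan_def)
    finally show ?thesis by simp
  qed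
  have eq: "is_codeword (V A xs) (l A xs) e r \<longleftrightarrow> V A xs e \<and> length r = Suc (l A xs e) \<and>
      S A xs e * 2 ^ Suc (l A xs e) \<le> str_index r * 2 ^ Suc e \<and>
      Suc (str_index r) * 2 ^ Suc e \<le> S A xs e * 2 ^ Suc (l A xs e) + 2 * 2 ^ Suc e" for A xs e r
  proof -
    let ?L = "Suc (l A xs e)"
    have "real (S A xs e) / 2 ^ Suc e \<le> real (str_index r) / 2 ^ ?L \<longleftrightarrow>
        real (S A xs e * 2 ^ ?L) \<le> real (str_index r * 2 ^ Suc e)"
      by (simp add: divide_simps del: power_Suc)
    moreover have "(real (str_index r) + 1) / 2 ^ ?L \<le> real (S A xs e) / 2 ^ Suc e + (1/2) ^ l A xs e
        \<longleftrightarrow> real (Suc (str_index r) * 2 ^ Suc e) \<le> real (S A xs e * 2 ^ ?L + 2 * 2 ^ Suc e)"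
    proof -
      have half: "(1/2::real) ^ l A xs e = 2 / 2 ^ ?L" by (simp add: power_one_over)
      have "b / M \<le> c / D + 2 / M \<longleftrightarrow> b * D \<le> c * M + 2 * D" if "0 < M" "0 < D" for b c D M :: real
        using that by (simp add: field_simps)
      from this[of "2 ^ ?L" "2 ^ Suc e" "real (str_index r) + 1" "real (S A xs e)"]
      show ?thesis unfolding half by (simp add: add.commute distrib_right)
    qed
    ultimately show ?thesis unfolding is_codeword_def S of_nat_le_iff by auto
  qed
  have tail: "recursive_in (Suc (Suc n)) (\<lambda>A zs. (hd zs # tl (tl zs)) ! i)" if "i < Suc n" for i
    using that by (cases i) (auto intro!: recursive_in_vars)
  have tail': "recursive_in (Suc (Suc (Suc n))) (\<lambda>A zs. (hd zs # tl (tl (tl zs))) ! i)"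
    if "i < Suc n" for i
    using that by (cases i) (auto intro!: recursive_in_vars)
  have V2: "decidable_in (Suc (Suc n)) (\<lambda>A zs. V A (tl (tl zs)) (hd zs))"
    using recursive_in_compose[OF V[unfolded decidable_in_def] _ tail] unfolding decidable_in_def by simp
  have l2: "recursive_in (Suc (Suc n)) (\<lambda>A zs. l A (tl (tl zs)) (hd zs))"
    using recursive_in_compose[OF l _ tail] by simp
  have V3: "decidable_in (Suc (Suc (Suc n))) (\<lambda>A zs. V A (tl (tl (tl zs))) (hd zs))"
    using recursive_in_compose[OF V[unfolded decidable_in_def] _ tail'] unfolding decidable_in_def by simp
  have l3: "recursive_in (Suc (Suc (Suc n))) (\<lambda>A zs. l A (tl (tl (tl zs))) (hd zs))"
    using recursive_in_compose[OF l _ tail'] by simp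
  show ?thesis unfolding eq S_def
    by (intro recursive_in_intros recursive_in_length_nat_str recursive_in_str_index V2 V3 l2 l3) auto
qed

lemma decidable_in_binary:
  assumes "decidable_in 2 (\<lambda>A zs. P A (hd zs) (hd (tl zs)))" "recursive_in n F" "recursive_in n G"
  shows "decidable_in n (\<lambda>A xs. P A (F A xs) (G A xs))"
proof -
  have "recursive_in n (\<lambda>A xs. [F A xs, G A xs] ! i)" if "i < 2" for i
    using that assms(2,3) by (cases i) auto
  from recursive_in_compose[OF assms(1)[unfolded decidable_in_def] _ this]
  show ?thesis unfolding decidable_in_def by simp
qed

section \<open>Machines given by search\<close>

lemma run_eq_Some_iff: "run A M s = Some x \<longleftrightarrow> eval A M [str_nat s] (str_nat x)"
proof -
  have "run A M s = Some x \<longleftrightarrow> (\<exists>y. compute A M [str_nat s] = Some y \<and> nat_str y = x)"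
    unfolding run_def by auto
  then show ?thesis unfolding compute_eq_Some_iff by (metis nat_str_str_nat str_nat_nat_str)
qed

lemma run_eq_Some_iff_fuel: "run A M s = Some x \<longleftrightarrow> (\<exists>t. fuel M A t [str_nat s] = Suc (str_nat x))"
  unfolding run_eq_Some_iff eval_iff_fuel ..

lemma fuel_run: "fuel M A t [str_nat s] = Suc y \<Longrightarrow> run A M s = Some (nat_str y)"
  unfolding run_eq_Some_iff_fuel by auto

lemma str_nat_inject [simp]: "str_nat s = str_nat t \<longleftrightarrow> s = t"
  by (metis nat_str_str_nat)

lemma universal_prefix_free:
  "universal U \<Longrightarrow> run A U p \<noteq> None \<Longrightarrow> run A U q \<noteq> None \<Longrightarrow> prefix p q \<Longrightarrow> p = q"
  unfolding universal_def prefix_free_machine_def by blast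

text \<open>The search halts exactly on the strings that have a witness, so \<open>pf\<close>, which
  compares arbitrary witnesses, is prefix-freeness of its domain under each oracle.\<close>

lemma universal_search:
  assumes "universal U" "decidable_in 2 (\<lambda>A zs. P A (hd zs) (hd (tl zs)))"
    "recursive_in 2 (\<lambda>A zs. G A (hd zs) (hd (tl zs)))"
    and pf: "\<And>A v w s t. P A v (str_nat s) \<Longrightarrow> P A w (str_nat t) \<Longrightarrow> prefix s t \<Longrightarrow> s = t"
  obtains q where "\<And>A s. run A U (q @ s) = (if \<exists>w. P A w (str_nat s)
    then Some (nat_str (G A (LEAST w. P A w (str_nat s)) (str_nat s))) else None)"
proof -
  obtain M where M: "\<And>A x. compute A M [x] =
      (if \<exists>w. P A w x then Some (G A (LEAST w. P A w x) x) else None)"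
    using exists_search_machine[OF assms(2,3)] by blast
  have run: "run A M s = (if \<exists>w. P A w (str_nat s)
    then Some (nat_str (G A (LEAST w. P A w (str_nat s)) (str_nat s))) else None)" for A s
    unfolding run_def M by simp
  have "prefix_free_machine M"
    unfolding prefix_free_machine_def run using pf by (auto split: if_splits)
  then obtain q where "\<And>A s. run A U (q @ s) = run A M s"
    using assms(1) unfolding universal_def by blast
  then show thesis unfolding run by (rule that)
qed

lemma KA_le: "run A U p = Some x \<Longrightarrow> KA U A x \<le> length p"
  unfolding KA_def by (rule Least_le) blast

section \<open>Unary programs and halting queries\<close>

definition unary :: "nat \<Rightarrow> bool list" where
  "unary n = replicate n False @ [True]"

text \<open>The binary numeral is 11 followed by \<open>n\<close> zeros, which makes the code of
  \<open>unary n\<close> computable from \<open>n\<close>.\<close>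

lemma Suc_str_nat_unary: "Suc (str_nat (unary n)) = 3 * 2 ^ n"
  by (induction n) (auto simp: unary_def)

lemma unary_prefix_free: "prefix (unary m) (unary n) \<Longrightarrow> m = n"
proof (induction m arbitrary: n)
  case 0
  then show ?case by (cases n) (auto simp: unary_def)
next
  case S: (Suc m)
  show ?case
  proof (cases n)
    case 0
    then show ?thesis using S.prems by (simp add: unary_def)
  next
    case (Suc k)
    then have "prefix (unary m) (unary k)" using S.prems by (simp add: unary_def)
    then show ?thesis using S.IH Suc by blast
  qed
qed

text \<open>Serves two ends: with a trivial \<open>P\<close> it gives every string some program, and
  with a general \<open>P\<close> it turns a search into a halting question. Program length is
  irrelevant for both, so unary input is good enough.\<close>

lemma universal_unary:
  assumes "universal U" and P: "decidable_in 2 (\<lambda>A zs. P A (hd zs) (hd (tl zs)))"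
  obtains q where "\<And>A n. run A U (q @ unary n) = (if \<exists>t. P A t n then Some (nat_str n) else None)"
proof -
  define Q where "Q A w x \<longleftrightarrow> Suc x = 3 * 2 ^ fst (prod_decode w) \<and>
    P A (snd (prod_decode w)) (fst (prod_decode w))" for A w x
  have Q: "Q A w (str_nat s) \<longleftrightarrow> s = unary (fst (prod_decode w)) \<and>
      P A (snd (prod_decode w)) (fst (prod_decode w))" for A w s
    unfolding Q_def Suc_str_nat_unary[symmetric] by simp
  have "decidable_in 2 (\<lambda>A zs. Q A (hd zs) (hd (tl zs)))"
    unfolding Q_def
    by (intro recursive_in_intros recursive_in_fst_prod_decode recursive_in_snd_prod_decode
        decidable_in_binary[OF P]) auto
  moreover have "recursive_in 2 (\<lambda>A zs. fst (prod_decode (hd zs)))"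
    by (intro recursive_in_fst_prod_decode recursive_in_vars) simp
  moreover have "s = t" if "Q A v (str_nat s)" "Q A w (str_nat t)" "prefix s t" for A v w s t
  proof -
    have "s = unary (fst (prod_decode v))" "t = unary (fst (prod_decode w))"
      using that(1,2) unfolding Q by auto
    then show ?thesis using unary_prefix_free that(3) by metis
  qed
  ultimately obtain q where q: "\<And>A s. run A U (q @ s) = (if \<exists>w. Q A w (str_nat s)
      then Some (nat_str (fst (prod_decode (LEAST w. Q A w (str_nat s))))) else None)"
    using universal_search[OF assms(1), of Q "\<lambda>A w x. fst (prod_decode w)"] by blast
  have "run A U (q @ unary n) = (if \<exists>t. P A t n then Some (nat_str n) else None)" for A n
  proof -
    have Q': "Q A w (str_nat (unary n)) \<longleftrightarrow> fst (prod_decode w) = n \<and> P A (snd (prod_decode w)) n" for w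
      unfolding Q using unary_prefix_free[of n "fst (prod_decode w)"] by (cases "fst (prod_decode w) = n") auto
    have ex: "(\<exists>w. Q A w (str_nat (unary n))) \<longleftrightarrow> (\<exists>t. P A t n)"
    proof
      assume "\<exists>t. P A t n"
      then obtain t where "P A t n" by blast
      then have "Q A (prod_encode (n, t)) (str_nat (unary n))" unfolding Q' by simp
      then show "\<exists>w. Q A w (str_nat (unary n))" by blast
    qed (use Q' in blast)
    show ?thesis
    proof (cases "\<exists>t. P A t n")
      case True
      then have "Q A (LEAST w. Q A w (str_nat (unary n))) (str_nat (unary n))"
        using ex by (metis (no_types, lifting) LeastI_ex)
      then have "fst (prod_decode (LEAST w. Q A w (str_nat (unary n)))) = n" unfolding Q' by simp
      then show ?thesis using True ex unfolding q by simp
    next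
      case False
      then show ?thesis using ex unfolding q by simp
    qed
  qed
  then show thesis by (rule that)
qed

lemma decidable_in_True: "decidable_in n (\<lambda>A xs. True)"
  by (simp add: decidable_in_def recursive_in_const)

text \<open>\<open>KA\<close> is a \<open>LEAST\<close> and says something only if some program
  exists; the unary one suffices.\<close>

lemma KA_witness:
  assumes "universal U"
  obtains p where "length p = KA U A x" "run A U p = Some x"
proof -
  obtain q where "\<And>A n. run A U (q @ unary n) = Some (nat_str n)"
    using universal_unary[OF assms, of "\<lambda>_ _ _. True"] decidable_in_True by auto
  then have "run A U (q @ unary (str_nat x)) = Some x" by simp
  then have "\<exists>n p. length p = n \<and> run A U p = Some x" by blast
  then have "\<exists>p. length p = KA U A x \<and> run A U p = Some x"
    unfolding KA_def by (rule LeastI_ex)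
  then show thesis using that by blast
qed

text \<open>The oracle knows only the domain of \<open>U\<close>, so the question
  \<open>\<exists>t. P t n\<close> is rephrased as the halting of a program that is computable from
  \<open>n\<close>.\<close>

lemma halting_query:
  assumes "universal U" and P: "decidable_in 2 (\<lambda>A zs. P (hd zs) (hd (tl zs)))"
  obtains q where "\<And>n. halting_seq U (q n) \<longleftrightarrow> (\<exists>t. P t n)"
    and "\<And>n F. recursive_in n F \<Longrightarrow> recursive_in n (\<lambda>A xs. q (F A xs))"
proof -
  obtain p where p: "\<And>A n. run A U (p @ unary n) = (if \<exists>t. P t n then Some (nat_str n) else None)"
    using universal_unary[OF assms(1), of "\<lambda>_. P"] P by blast
  have "halting_seq U (str_nat (p @ unary n)) \<longleftrightarrow> (\<exists>t. P t n)" for n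
    unfolding halting_seq_def by (simp add: p)
  moreover have "recursive_in n (\<lambda>A xs. str_nat (p @ unary (F A xs)))" if "recursive_in n F" for n F
  proof -
    have eq: "str_nat (p @ unary k) = str_nat p + 2 ^ length p * (3 * 2 ^ k - 1)" for k
      using Suc_str_nat_unary[of k] by (simp add: str_nat_append flip: Suc_str_nat_unary)
    show ?thesis unfolding eq by (intro recursive_in_intros that)
  qed
  ultimately show thesis by (rule that)
qed

text \<open>A program may behave differently once the oracle becomes \<open>halting_seq U\<close>; a
  prefix of constant length makes \<open>U\<close> simulate its own run with
  \<open>no_oracle\<close>.\<close>

lemma KH_le_K:
  assumes "universal U"
  shows "\<exists>c. \<forall>x. KH U x \<le> K U x + c"
proof -
  let ?P = "\<lambda>(A :: nat \<Rightarrow> bool) t x. fuel U no_oracle t [x] \<noteq> 0"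
  let ?G = "\<lambda>(A :: nat \<Rightarrow> bool) t x. fuel U no_oracle t [x] - 1"
  have "decidable_in 2 (\<lambda>A zs. ?P A (hd zs) (hd (tl zs)))"
    by (intro recursive_in_intros recursive_in_fuel_no_oracle) auto
  moreover have "recursive_in 2 (\<lambda>A zs. ?G A (hd zs) (hd (tl zs)))"
    by (intro recursive_in_intros recursive_in_fuel_no_oracle) auto
  moreover have halts: "run no_oracle U s \<noteq> None" if "?P A t (str_nat s)" for A :: "nat \<Rightarrow> bool" and t s
    using that fuel_run[of U no_oracle t s] by (metis not0_implies_Suc option.distinct(1))
  have "s = t" if "?P A v (str_nat s)" "?P A w (str_nat t)" "prefix s t"
    for A :: "nat \<Rightarrow> bool" and v w s t
    using universal_prefix_free[OF assms] halts that by blast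
  ultimately obtain q where q: "\<And>A s. run A U (q @ s) = (if \<exists>w. ?P A w (str_nat s)
      then Some (nat_str (?G A (LEAST w. ?P A w (str_nat s)) (str_nat s))) else None)"
    using universal_search[OF assms, of ?P ?G] by blast
  have "KH U x \<le> K U x + length q" for x
  proof -
    obtain p where p: "length p = K U x" "run no_oracle U p = Some x"
      using KA_witness[OF assms] unfolding K_def by blast
    then have ex: "\<exists>t. ?P A t (str_nat p)" for A :: "nat \<Rightarrow> bool"
      unfolding run_eq_Some_iff_fuel by (metis Zero_not_Suc)
    define t where "t = (LEAST t. fuel U no_oracle t [str_nat p] \<noteq> 0)"
    have "fuel U no_oracle t [str_nat p] \<noteq> 0" unfolding t_def by (rule LeastI_ex) (rule ex)
    then obtain y where y: "fuel U no_oracle t [str_nat p] = Suc y" using not0_implies_Suc by blast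
    then have "nat_str y = x" using fuel_run p(2) by fastforce
    then have "run (halting_seq U) U (q @ p) = Some x"
      using q ex y by (simp add: t_def)
    then show ?thesis using KA_le p(1) unfolding KH_def by fastforce
  qed
  then show ?thesis by blast
qed

section \<open>The output distribution of a composition\<close>

text \<open>\<open>mass U F s y\<close> is the stage \<open>s\<close> approximation from below to the probability that \<open>F\<close> after
  \<open>U\<close> outputs \<open>y\<close>.\<close>

definition image_fuel :: "rf \<Rightarrow> rf \<Rightarrow> nat \<Rightarrow> nat \<Rightarrow> nat" where
  "image_fuel U F t p = (if fuel U no_oracle t [p] = 0 then 0
     else fuel F no_oracle t [fuel U no_oracle t [p] - 1])"

definition mass :: "rf \<Rightarrow> rf \<Rightarrow> nat \<Rightarrow> nat \<Rightarrow> real" where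
  "mass U F s y = (\<Sum>p\<in>{p. p < s \<and> image_fuel U F s p = Suc y}. (1/2) ^ length (nat_str p))"

text \<open>The threshold must be crossed at a finite stage rather than in the limit, so that
  \<open>\<exists>s. heavy U F s y k\<close> is a question for the halting sequence.\<close>

definition heavy :: "rf \<Rightarrow> rf \<Rightarrow> nat \<Rightarrow> nat \<Rightarrow> nat \<Rightarrow> bool" where
  "heavy U F s y k \<longleftrightarrow> (1/2) ^ k \<le> mass U F s y"

lemma image_fuel_mono:
  assumes "image_fuel U F t p = Suc y" "t \<le> u"
  shows "image_fuel U F u p = Suc y"
proof -
  obtain x where x: "fuel U no_oracle t [p] = Suc x"
    using assms(1) unfolding image_fuel_def by (cases "fuel U no_oracle t [p]") auto
  then show ?thesis
    using assms fuel_mono[OF x assms(2)] fuel_mono[of F no_oracle t "[x]" y u]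
    unfolding image_fuel_def by simp
qed

lemma image_fuel_halts: "image_fuel U F t p = Suc y \<Longrightarrow> run no_oracle U (nat_str p) \<noteq> None"
  using fuel_run[of U no_oracle t "nat_str p"] unfolding image_fuel_def
  by (cases "fuel U no_oracle t [p]") auto

lemma ex_image_fuel:
  assumes "run no_oracle U p = Some x" "run no_oracle F x = Some y"
  shows "\<exists>t. image_fuel U F t (str_nat p) = Suc (str_nat y)"
proof -
  obtain t u where t: "fuel U no_oracle t [str_nat p] = Suc (str_nat x)"
    and u: "fuel F no_oracle u [str_nat x] = Suc (str_nat y)"
    using assms unfolding run_eq_Some_iff_fuel by blast
  have "image_fuel U F (max t u) (str_nat p) = Suc (str_nat y)"
    using fuel_mono[OF t, of "max t u"] fuel_mono[OF u, of "max t u"] by (simp add: image_fuel_def)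
  then show ?thesis by blast
qed

lemma recursive_in_image_fuel:
  "recursive_in n T \<Longrightarrow> recursive_in n P \<Longrightarrow> recursive_in n (\<lambda>A xs. image_fuel U F (T A xs) (P A xs))"
  unfolding image_fuel_def by (intro recursive_in_intros recursive_in_fuel_no_oracle)

lemma mass_nonneg: "0 \<le> mass U F s y"
  unfolding mass_def by (intro sum_nonneg) auto

lemma mass_mono: "s \<le> t \<Longrightarrow> mass U F s y \<le> mass U F t y"
  unfolding mass_def by (intro sum_mono2) (auto dest: image_fuel_mono)

lemma heavy_mono: "heavy U F s y k \<Longrightarrow> s \<le> t \<Longrightarrow> heavy U F t y k"
  unfolding heavy_def using mass_mono order_trans by blast

text \<open>Distinct \<open>y\<close> are produced by disjoint sets of programs, all in the
  prefix-free domain of \<open>U\<close>, so Kraft's inequality bounds the total.\<close>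

lemma sum_mass_le_1:
  assumes "universal U" "finite Y"
  shows "(\<Sum>y\<in>Y. mass U F s y) \<le> 1"
proof -
  define P where "P y = {p. p < s \<and> image_fuel U F s p = Suc y}" for y
  have "(\<Sum>y\<in>Y. mass U F s y) = (\<Sum>p\<in>(\<Union>y\<in>Y. P y). (1/2) ^ length (nat_str p))"
    unfolding mass_def P_def[symmetric]
    using assms(2) by (intro sum.UNION_disjoint[symmetric]) (auto simp: P_def)
  also have "\<dots> = (\<Sum>p\<in>nat_str ` (\<Union>y\<in>Y. P y). (1/2) ^ length p)"
    by (subst sum.reindex) (auto intro: inj_on_inverseI[of _ str_nat])
  also have "\<dots> \<le> 1"
  proof (rule kraft_inequality)
    show "finite (nat_str ` (\<Union>y\<in>Y. P y))" using assms(2) by (auto simp: P_def)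
    show "p = q" if "p \<in> nat_str ` (\<Union>y\<in>Y. P y)" "q \<in> nat_str ` (\<Union>y\<in>Y. P y)" "prefix p q" for p q
    proof -
      have halts: "run no_oracle U r \<noteq> None" if "r \<in> nat_str ` (\<Union>y\<in>Y. P y)" for r
        using that image_fuel_halts unfolding P_def by fastforce
      show ?thesis
        by (rule universal_prefix_free[OF assms(1) halts[OF that(1)] halts[OF that(2)] that(3)])
    qed
  qed
  finally show ?thesis .
qed

lemma mass_ge:
  assumes "finite P" "\<And>p. p \<in> P \<Longrightarrow> p < s \<and> image_fuel U F s p = Suc y"
  shows "(\<Sum>p\<in>P. (1/2) ^ length (nat_str p)) \<le> mass U F s y"
  unfolding mass_def using assms by (intro sum_mono2) auto

lemma decidable_in_heavy:
  assumes "recursive_in n S" "recursive_in n Y" "recursive_in n L"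
  shows "decidable_in n (\<lambda>A xs. heavy U F (S A xs) (Y A xs) (L A xs))"
proof -
  \<comment> \<open>After multiplication by \<open>2 ^ s\<close> all weights are natural, since
    programs \<open>p < s\<close> have length at most \<open>s\<close>.\<close>
  have eq: "heavy U F s y k \<longleftrightarrow>
    (2::nat) ^ s \<le> 2 ^ k * (\<Sum>p<s. of_bool (image_fuel U F s p = Suc y) * 2 ^ (s - length (nat_str p)))" for s y k
  proof -
    let ?N = "\<Sum>p<s. of_bool (image_fuel U F s p = Suc y) * 2 ^ (s - length (nat_str p)) :: nat"
    have "real ?N / 2 ^ s = (\<Sum>p<s. if image_fuel U F s p = Suc y then (1/2) ^ length (nat_str p) else 0)"
      unfolding of_nat_sum sum_divide_distrib
    proof (intro sum.cong refl)
      fix p assume "p \<in> {..<s}"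
      then have "length (nat_str p) \<le> s" using length_nat_str_le[of p] by simp
      then have "(2::real) ^ (s - length (nat_str p)) / 2 ^ s = (1/2) ^ length (nat_str p)"
        by (simp add: power_diff power_one_over field_simps)
      then show "real (of_bool (image_fuel U F s p = Suc y) * 2 ^ (s - length (nat_str p))) / 2 ^ s
          = (if image_fuel U F s p = Suc y then (1/2) ^ length (nat_str p) else 0)" by simp
    qed
    also have "\<dots> = mass U F s y"
      unfolding mass_def by (subst sum.inter_filter[symmetric]) (auto simp: lessThan_def)
    finally have "heavy U F s y k \<longleftrightarrow> real (2 ^ s) \<le> real (2 ^ k * ?N)"
      unfolding heavy_def by (simp add: power_one_over field_simps)
    then show ?thesis unfolding of_nat_le_iff .
  qed
  have "recursive_in 3 (\<lambda>A xs. of_bool (heavy U F (hd xs) (hd (tl xs)) (hd (tl (tl xs)))))"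
    unfolding eq
    by (intro recursive_in_intros recursive_in_image_fuel recursive_in_length_nat_str) auto
  moreover have "recursive_in n (\<lambda>A xs. [S A xs, Y A xs, L A xs] ! i)" if "i < 3" for i
  proof -
    have "i = 0 \<or> i = 1 \<or> i = 2" using that by auto
    then show ?thesis using assms by auto
  qed
  ultimately have "recursive_in n (\<lambda>A xs. of_bool (heavy U F (S A xs) (Y A xs) (L A xs)))"
    using recursive_in_compose[where L = "\<lambda>A xs. [S A xs, Y A xs, L A xs]" and n = n and m = 3]
    by force
  then show ?thesis unfolding decidable_in_def .
qed

section \<open>Coding theorem for the output distribution\<close>

lemma sum_half_power_Suc_le:
  assumes "finite L" "\<And>k. k \<in> L \<Longrightarrow> (1/2) ^ k \<le> (m::real)" "0 \<le> m"
  shows "(\<Sum>k\<in>L. (1/2) ^ Suc k) \<le> m"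
proof (cases "L = {}")
  case False
  \<comment> \<open>The geometric series starting at the least exponent stays below
    \<open>(1/2) ^ a\<close>, and \<open>a\<close> is itself in \<open>L\<close>.\<close>
  define a where "a = Min L"
  have tele: "(\<Sum>k=a..<a + n. (1/2::real) ^ Suc k) = (1/2) ^ a - (1/2) ^ (a + n)" for n
  proof (induction n)
    case (Suc n)
    have "(1/2::real) ^ (a + n) = 2 * (1/2) ^ Suc (a + n)" by simp
    then show ?case using Suc by simp
  qed simp
  have "L \<subseteq> {a..<a + Suc (Max L)}"
    using assms(1) by (auto simp: a_def less_Suc_eq_le trans_le_add2)
  then have "(\<Sum>k\<in>L. (1/2::real) ^ Suc k) \<le> (\<Sum>k=a..<a + Suc (Max L). (1/2) ^ Suc k)"
    by (intro sum_mono2) auto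
  also have "\<dots> \<le> (1/2) ^ a" unfolding tele by simp
  also have "\<dots> \<le> m" using assms(1,2) False by (simp add: a_def)
  finally show ?thesis .
qed (use assms in simp)

text \<open>Request \<open>e = (s, y, k)\<close>: the mass of \<open>y\<close> reaches \<open>2 ^ -k\<close> at stage \<open>s\<close>.\<close>

definition threshold_request :: "rf \<Rightarrow> rf \<Rightarrow> nat \<Rightarrow> bool" where
  "threshold_request U F e \<longleftrightarrow>
     heavy U F (fst (prod_decode e)) (fst (prod_decode (snd (prod_decode e))))
       (snd (prod_decode (snd (prod_decode e)))) \<and>
     (\<forall>s<fst (prod_decode e). \<not> heavy U F s (fst (prod_decode (snd (prod_decode e))))
       (snd (prod_decode (snd (prod_decode e)))))"

text \<open>The \<open>Suc\<close> halves every weight, so that all thresholds passed by one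
  \<open>y\<close> together cost at most its mass.\<close>

definition threshold_length :: "nat \<Rightarrow> nat" where
  "threshold_length e = Suc (snd (prod_decode (snd (prod_decode e))))"

text \<open>Asking for the first heavy stage lets each pair \<open>(y, k)\<close> occur in one
  request only, so the sum splits into the thresholds of each \<open>y\<close>. At the late stage
  \<open>S\<close> these are bounded by the masses, whose sum is at most 1.\<close>

lemma threshold_request_sum_le_1:
  assumes "universal U" "finite E" "\<forall>e\<in>E. threshold_request U F e"
  shows "(\<Sum>e\<in>E. (1/2::real) ^ threshold_length e) \<le> 1"
proof -
  define S where "S = Max (insert 0 ((\<lambda>e. fst (prod_decode e)) ` E))"
  define g where "g e = prod_decode (snd (prod_decode e))" for e
  define Y where "Y = fst ` g ` E"
  define L where "L = (\<lambda>y. {k. (y, k) \<in> g ` E})"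
  have req: "heavy U F (fst (prod_decode e)) (fst (g e)) (snd (g e))"
    "\<And>s. s < fst (prod_decode e) \<Longrightarrow> \<not> heavy U F s (fst (g e)) (snd (g e))" if "e \<in> E" for e
    using assms(3) that unfolding threshold_request_def g_def by auto
  have sections: "R = Sigma (fst ` R) (\<lambda>y. {k. (y, k) \<in> R})" for R :: "(nat \<times> nat) set"
    by force
  have fin: "finite Y" "finite (L y)" for y
  proof -
    show "finite Y" using assms(2) by (simp add: Y_def)
    have "{k. (y, k) \<in> R} \<subseteq> snd ` R" for R :: "(nat \<times> nat) set"
      by force
    then have "L y \<subseteq> snd ` g ` E" unfolding L_def .
    then show "finite (L y)" using assms(2) finite_subset by blast
  qed
  have "inj_on g E"
  proof (rule inj_onI)
    fix e f assume ef: "e \<in> E" "f \<in> E" "g e = g f"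
    have "\<not> fst (prod_decode e) < fst (prod_decode f)" "\<not> fst (prod_decode f) < fst (prod_decode e)"
      using req[OF ef(1)] req[OF ef(2)] ef(3) by auto
    then have "fst (prod_decode e) = fst (prod_decode f)" by simp
    moreover have "snd (prod_decode e) = snd (prod_decode f)"
      using ef(3) unfolding g_def by (metis prod_decode_inverse)
    ultimately show "e = f" by (metis prod_eqI prod_decode_inverse)
  qed
  then have "(\<Sum>z\<in>g ` E. (1/2::real) ^ Suc (snd z)) = (\<Sum>e\<in>E. (1/2) ^ Suc (snd (g e)))"
    by (simp add: sum.reindex)
  then have "(\<Sum>e\<in>E. (1/2::real) ^ threshold_length e) = (\<Sum>z\<in>g ` E. (1/2) ^ Suc (snd z))"
    by (simp add: threshold_length_def g_def)
  also have "g ` E = Sigma Y L" unfolding Y_def L_def by (rule sections)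
  also have "(\<Sum>z\<in>Sigma Y L. (1/2::real) ^ Suc (snd z)) = (\<Sum>y\<in>Y. \<Sum>k\<in>L y. (1/2) ^ Suc k)"
    using fin by (subst sum.Sigma) (auto simp: case_prod_unfold)
  also have "\<dots> \<le> (\<Sum>y\<in>Y. mass U F S y)"
  proof (intro sum_mono sum_half_power_Suc_le fin mass_nonneg)
    fix y k assume "k \<in> L y"
    then obtain e where e: "e \<in> E" "g e = (y, k)" by (auto simp: L_def)
    then have "fst (prod_decode e) \<le> S" using assms(2) unfolding S_def by (intro Max_ge) auto
    then have "heavy U F S y k" using req(1)[OF e(1)] e(2) heavy_mono by simp
    then show "(1/2) ^ k \<le> mass U F S y" by (simp add: heavy_def)
  qed
  also have "\<dots> \<le> 1" using sum_mass_le_1[OF assms(1)] fin(1) by blast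
  finally show ?thesis .
qed

text \<open>The coding theorem for the distribution of the outputs of \<open>F\<close> after \<open>U\<close>.\<close>

lemma K_le_of_heavy:
  assumes "universal U"
  shows "\<exists>c. \<forall>s y k. heavy U F s y k \<longrightarrow> K U (nat_str y) \<le> k + c"
proof -
  let ?P = "\<lambda>(A :: nat \<Rightarrow> bool) e x. is_codeword (threshold_request U F) threshold_length e (nat_str x)"
  let ?G = "\<lambda>(A :: nat \<Rightarrow> bool) e (x :: nat). fst (prod_decode (snd (prod_decode e)))"
  have "decidable_in (Suc 0) (\<lambda>A zs. threshold_request U F (hd zs))"
    unfolding threshold_request_def
    by (intro recursive_in_intros decidable_in_heavy recursive_in_fst_prod_decode
        recursive_in_snd_prod_decode) auto
  moreover have "recursive_in (Suc 0) (\<lambda>A zs. threshold_length (hd zs))"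
    unfolding threshold_length_def
    by (intro recursive_in_intros recursive_in_snd_prod_decode) auto
  moreover have "threshold_length e \<le> Suc e" for e
    unfolding threshold_length_def using snd_prod_decode_le order_trans by blast
  ultimately have "decidable_in 2 (\<lambda>A zs. ?P A (hd zs) (hd (tl zs)))"
    using decidable_in_is_codeword[of 0 "\<lambda>_ _. threshold_request U F" "\<lambda>_ _. threshold_length"]
    by (simp add: numeral_2_eq_2)
  moreover have "recursive_in 2 (\<lambda>A zs. ?G A (hd zs) (hd (tl zs)))"
    by (intro recursive_in_fst_prod_decode recursive_in_snd_prod_decode recursive_in_vars) auto
  moreover have pf: "v = w \<and> s = t" if "?P A v (str_nat s)" "?P A w (str_nat t)" "prefix s t"
    for A :: "nat \<Rightarrow> bool" and v w s t
    using that is_codeword_prefix_free by simp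
  ultimately obtain q where q: "\<And>A s. run A U (q @ s) = (if \<exists>w. ?P A w (str_nat s)
      then Some (nat_str (?G A (LEAST w. ?P A w (str_nat s)) (str_nat s))) else None)"
    using universal_search[OF assms, of ?P ?G] by blast
  \<comment> \<open>The 2 is one bit from \<open>threshold_length\<close> and one from
    \<open>is_codeword\<close>.\<close>
  have "K U (nat_str y) \<le> k + (length q + 2)" if heavy: "heavy U F s y k" for s y k
  proof -
    define s' where "s' = (LEAST s. heavy U F s y k)"
    have s': "heavy U F s' y k" "\<And>s. s < s' \<Longrightarrow> \<not> heavy U F s y k"
      unfolding s'_def using heavy by (auto intro: LeastI dest: not_less_Least)
    define e where "e = prod_encode (s', prod_encode (y, k))"
    have "threshold_request U F e" using s' by (simp add: threshold_request_def e_def)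
    then obtain r where r: "is_codeword (threshold_request U F) threshold_length e r"
      using ex_codeword threshold_request_sum_le_1[OF assms] by metis
    \<comment> \<open>A codeword determines its request, so the least witness is the intended
      one.\<close>
    have least: "(LEAST w. ?P no_oracle w (str_nat r)) = e"
    proof (rule Least_equality)
      show "?P no_oracle e (str_nat r)" using r by simp
      fix w assume "?P no_oracle w (str_nat r)"
      then have "w = e \<and> r = r" using r by (intro pf) simp_all
      then show "e \<le> w" by simp
    qed
    have "\<exists>w. ?P no_oracle w (str_nat r)" using r by auto
    then have "run no_oracle U (q @ r) = Some (nat_str y)"
      using q[of no_oracle r] unfolding least by (simp add: e_def)
    then have "K U (nat_str y) \<le> length (q @ r)" unfolding K_def by (rule KA_le)
    then show ?thesis using r by (simp add: is_codeword_def threshold_length_def e_def)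
  qed
  then show ?thesis by blast
qed

section \<open>Codes for preimages\<close>

text \<open>Request \<open>e = (t, p)\<close>: the program \<open>p\<close> is found at stage \<open>t\<close> to have image \<open>y\<close>.\<close>

definition preimage_request :: "rf \<Rightarrow> rf \<Rightarrow> nat \<Rightarrow> nat \<Rightarrow> bool" where
  "preimage_request U F y e \<longleftrightarrow>
     image_fuel U F (fst (prod_decode e)) (snd (prod_decode e)) = Suc y \<and>
     (\<forall>t<fst (prod_decode e). image_fuel U F t (snd (prod_decode e)) \<noteq> Suc y)"

text \<open>The length belonging to the weight \<open>2 ^ -|p|\<close> divided by
  \<open>2 ^ (1 - k)\<close>, the known bound on the mass of \<open>y\<close>; hence the
  \<open>Suc\<close>.\<close>

definition preimage_length :: "nat \<Rightarrow> nat \<Rightarrow> nat" where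
  "preimage_length k e = Suc (length (nat_str (snd (prod_decode e)))) - k"

lemma preimage_request_sum_le_1:
  assumes "universal U" "\<And>s j. j < k \<Longrightarrow> \<not> heavy U F s y j"
    and "finite E" "\<forall>e\<in>E. preimage_request U F y e"
  shows "(\<Sum>e\<in>E. (1/2::real) ^ preimage_length k e) \<le> 1"
proof -
  define g where "g e = snd (prod_decode e)" for e
  define S where "S = Max (insert 0 ((\<lambda>e. max (fst (prod_decode e)) (Suc (g e))) ` E))"
  define l where "l e = length (nat_str (g e))" for e
  have req: "image_fuel U F (fst (prod_decode e)) (g e) = Suc y"
    "\<And>t. t < fst (prod_decode e) \<Longrightarrow> image_fuel U F t (g e) \<noteq> Suc y" if "e \<in> E" for e
    using assms(4) that unfolding preimage_request_def g_def by auto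
  have inj: "inj_on g E"
  proof (rule inj_onI)
    fix e f assume ef: "e \<in> E" "f \<in> E" "g e = g f"
    have "\<not> fst (prod_decode e) < fst (prod_decode f)" "\<not> fst (prod_decode f) < fst (prod_decode e)"
      using req[OF ef(1)] req[OF ef(2)] ef(3) by auto
    then have "fst (prod_decode e) = fst (prod_decode f)" by simp
    then show "e = f" using ef(3) unfolding g_def by (metis prod_eqI prod_decode_inverse)
  qed
  have S: "p < S \<and> image_fuel U F S p = Suc y" if "p \<in> g ` E" for p
  proof -
    obtain e where e: "e \<in> E" "p = g e" using \<open>p \<in> g ` E\<close> by blast
    then have "max (fst (prod_decode e)) (Suc (g e)) \<le> S"
      using assms(3) unfolding S_def by (intro Max_ge) auto
    then show ?thesis using image_fuel_mono[OF req(1)[OF e(1)]] e(2) by simp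
  qed
  have mass: "(\<Sum>e\<in>D. (1/2) ^ l e) \<le> mass U F S y" if "D \<subseteq> E" for D
  proof -
    have "(\<Sum>e\<in>D. (1/2::real) ^ l e) = (\<Sum>p\<in>g ` D. (1/2) ^ length (nat_str p))"
      using inj_on_subset[OF inj that] by (simp add: sum.reindex l_def)
    also have "\<dots> \<le> mass U F S y"
      using assms(3) that finite_subset S by (intro mass_ge) blast+
    finally show ?thesis .
  qed
  show ?thesis
  proof (cases k)
    case 0
    \<comment> \<open>No smaller threshold is available here, but the mass never exceeds 1.\<close>
    have "(\<Sum>e\<in>E. (1/2::real) ^ preimage_length k e) = (1/2) * (\<Sum>e\<in>E. (1/2) ^ l e)"
      unfolding sum_distrib_left by (simp add: 0 preimage_length_def l_def g_def)
    also have "(\<Sum>e\<in>E. (1/2) ^ l e) \<le> mass U F S y" by (rule mass) simp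
    also have "mass U F S y \<le> 1" using sum_mass_le_1[OF assms(1), of "{y}"] by simp
    finally show ?thesis by simp
  next
    case (Suc j)
    then have light: "mass U F S y < (1/2) ^ j" using assms(2)[of j S] by (simp add: heavy_def)
    have "(1/2::real) ^ preimage_length k e = 2 ^ j * (1/2) ^ l e" if "e \<in> E" for e
    proof -
      \<comment> \<open>A single program is lighter than \<open>(1/2) ^ j\<close>, so it is longer
        than \<open>j\<close> and the truncated subtraction in \<open>preimage_length\<close> is
        exact.\<close>
      have "(1/2) ^ l e \<le> mass U F S y" using mass[of "{e}"] that by simp
      then have "(1/2) ^ l e < (1/2::real) ^ j" using light by linarith
      then have "j < l e" by (simp add: power_strict_decreasing_iff)
      then have "(1/2::real) ^ l e = (1/2) ^ j * (1/2) ^ (l e - j)"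
        by (simp flip: power_add)
      then show ?thesis using Suc by (simp add: preimage_length_def l_def g_def power_one_over)
    qed
    then have "(\<Sum>e\<in>E. (1/2::real) ^ preimage_length k e) = 2 ^ j * (\<Sum>e\<in>E. (1/2) ^ l e)"
      unfolding sum_distrib_left by (intro sum.cong) auto
    also have "\<dots> \<le> 2 ^ j * (1/2) ^ j"
      using mass[of E] light by (intro mult_left_mono) auto
    also have "\<dots> = (1::real)" by (simp add: power_one_over)
    finally show ?thesis .
  qed
qed

text \<open>The search condition of a machine that reads a program of the oracle machine for \<open>y\<close>
  followed by a codeword for a preimage of \<open>y\<close>. The length of the codeword depends on the least
  \<open>k\<close> with \<open>\<exists>s. heavy U F s y k\<close>; only the halting oracle finds it, by the queries \<open>Q\<close>. With any
  other oracle some \<open>k\<close>, still determined by \<open>y\<close>, is used, and the machine stays prefix-free.\<close>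

definition preimage_search ::
  "rf \<Rightarrow> rf \<Rightarrow> (nat \<Rightarrow> nat) \<Rightarrow> (nat \<Rightarrow> bool) \<Rightarrow> nat \<Rightarrow> nat \<Rightarrow> nat \<Rightarrow> nat \<Rightarrow> nat \<Rightarrow> nat \<Rightarrow> bool" where
  "preimage_search U F Q A a r t k e x \<longleftrightarrow>
     x = a + 2 ^ length (nat_str a) * r \<and> fuel U A t [a] \<noteq> 0 \<and>
     A (Q (prod_encode (fuel U A t [a] - 1, k))) \<and>
     (\<forall>j<k. \<not> A (Q (prod_encode (fuel U A t [a] - 1, j)))) \<and>
     is_codeword (preimage_request U F (fuel U A t [a] - 1)) (preimage_length k) e (nat_str r)"

text \<open>The parts are decoded in turn. The initial programs are comparable and halt under
  \<open>A\<close>, hence agree; so do their outputs, and therefore the \<open>k\<close> read from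
  the oracle. Now both remainders belong to the same code. The equality of requests is what fixes
  the output of the machine.\<close>

lemma preimage_search_prefix_free:
  assumes "universal U"
    "preimage_search U F Q A a r t k e (str_nat s)" "preimage_search U F Q A a' r' t' k' e' (str_nat s')"
    "prefix s s'"
  shows "e = e' \<and> s = s'"
proof -
  have parts: "s = nat_str a @ nat_str r \<and> run A U (nat_str a) = Some (nat_str (fuel U A t [a] - 1))"
    if "preimage_search U F Q A a r t k e (str_nat s)" for a r t k e s
  proof -
    have "str_nat s = str_nat (nat_str a @ nat_str r)"
      using that unfolding preimage_search_def by (simp add: str_nat_append)
    moreover have "fuel U A t [str_nat (nat_str a)] = Suc (fuel U A t [a] - 1)"
      using that unfolding preimage_search_def by simp
    ultimately show ?thesis using fuel_run by simp
  qed
  note s = parts[OF assms(2)] and s' = parts[OF assms(3)]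
  have "prefix (nat_str a) s'" "prefix (nat_str a') s'"
    using s s' assms(4) prefix_order.trans[of "nat_str a" s s'] by simp_all
  then have "prefix (nat_str a) (nat_str a') \<or> prefix (nat_str a') (nat_str a)"
    using prefix_same_cases by blast
  then have a: "nat_str a = nat_str a'"
    using universal_prefix_free[OF assms(1), of A] s s' by (metis option.distinct(1))
  then have y: "fuel U A t [a] - 1 = fuel U A t' [a'] - 1"
    using s s' by (metis option.inject str_nat_nat_str)
  have k: "k = k'"
    using assms(2,3) unfolding preimage_search_def y by (metis linorder_neqE_nat)
  have "prefix (nat_str r) (nat_str r')" using assms(4) s s' a by simp
  then have "e = e' \<and> nat_str r = nat_str r'"
    using assms(2,3) is_codeword_prefix_free unfolding preimage_search_def y k by blast
  then show ?thesis using s s' a by simp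
qed

lemma decidable_in_preimage_search:
  assumes Q: "\<And>n F. recursive_in n F \<Longrightarrow> recursive_in n (\<lambda>A xs. Q (F A xs))"
    and "recursive_in n a" "recursive_in n r" "recursive_in n t" "recursive_in n k" "recursive_in n e"
    "recursive_in n x"
  shows "decidable_in n (\<lambda>A xs. preimage_search U F Q A (a A xs) (r A xs) (t A xs) (k A xs)
    (e A xs) (x A xs))"
proof -
  have "decidable_in (Suc 2) (\<lambda>A zs. preimage_request U F (hd (tl zs)) (hd zs))"
    unfolding preimage_request_def
    by (intro recursive_in_intros recursive_in_image_fuel recursive_in_fst_prod_decode
        recursive_in_snd_prod_decode) auto
  moreover have "recursive_in (Suc 2) (\<lambda>A zs. preimage_length (hd (tl (tl zs))) (hd zs))"
    unfolding preimage_length_def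
    by (intro recursive_in_intros recursive_in_length_nat_str recursive_in_snd_prod_decode) auto
  moreover have "preimage_length k e \<le> Suc e" for k e
    unfolding preimage_length_def
    using length_nat_str_le[of "snd (prod_decode e)"] snd_prod_decode_le[of e] by linarith
  ultimately have base: "decidable_in (Suc (Suc 2)) (\<lambda>A zs. is_codeword
      (preimage_request U F (hd (tl (tl zs)))) (preimage_length (hd (tl (tl (tl zs)))))
      (hd zs) (nat_str (hd (tl zs))))"
    by (intro decidable_in_is_codeword[where V = "\<lambda>A xs. preimage_request U F (hd xs)"
          and l = "\<lambda>A xs. preimage_length (hd (tl xs))"])
  have code: "decidable_in n (\<lambda>A xs. is_codeword
      (preimage_request U F (y A xs)) (preimage_length (k A xs)) (e A xs) (nat_str (r A xs)))"
    if "recursive_in n y" for y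
  proof -
    have "recursive_in n (\<lambda>A xs. [e A xs, r A xs, y A xs, k A xs] ! i)" if "i < Suc (Suc 2)" for i
    proof -
      have "i = 0 \<or> i = 1 \<or> i = 2 \<or> i = 3" using that by auto
      then show ?thesis using assms \<open>recursive_in n y\<close> by auto
    qed
    from recursive_in_compose[OF base[unfolded decidable_in_def] _ this]
    show ?thesis unfolding decidable_in_def by simp
  qed
  have shift: "recursive_in (Suc n) (\<lambda>A zs. h A (tl zs))" if "recursive_in n h" for h
  proof -
    have "recursive_in (Suc n) (\<lambda>A zs. tl zs ! i)" if "i < n" for i
      using that by (intro recursive_in_vars) simp
    from recursive_in_compose[OF \<open>recursive_in n h\<close> _ this] show ?thesis by simp
  qed
  show ?thesis
    unfolding preimage_search_def
    by (intro recursive_in_intros recursive_in_length_nat_str recursive_in_fuel_relative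
        recursive_in_prod_encode Q code shift assms(2-)) auto
qed

text \<open>The same \<open>k\<close> is offered to \<open>K_le_of_heavy\<close>, so adding the two
  bounds cancels it.\<close>

lemma KH_le_of_image:
  assumes "universal U"
  obtains c where "\<And>x y. run no_oracle F x = Some y \<Longrightarrow>
    \<exists>s k. heavy U F s (str_nat y) k \<and> KH U x + k \<le> KH U y + K U x + c"
proof -
  let ?B = "\<lambda>t n. heavy U F t (fst (prod_decode n)) (snd (prod_decode n))"
  have "decidable_in 2 (\<lambda>A zs. ?B (hd zs) (hd (tl zs)))"
    by (intro decidable_in_heavy recursive_in_fst_prod_decode recursive_in_snd_prod_decode
        recursive_in_vars) auto
  then obtain Q where Q: "\<And>n. halting_seq U (Q n) \<longleftrightarrow> (\<exists>t. ?B t n)"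
    and rec_Q: "\<And>n F. recursive_in n F \<Longrightarrow> recursive_in n (\<lambda>A xs. Q (F A xs))"
    using halting_query[OF assms, of ?B] by blast
  \<comment> \<open>A witness packs the program for \<open>y\<close>, the codeword, the fuel,
    \<open>k\<close> and the request.\<close>
  define w1 w2 w3 w4 w5 where w_defs:
    "w1 w = fst (prod_decode w)"
    "w2 w = fst (prod_decode (snd (prod_decode w)))"
    "w3 w = fst (prod_decode (snd (prod_decode (snd (prod_decode w)))))"
    "w4 w = fst (prod_decode (snd (prod_decode (snd (prod_decode (snd (prod_decode w)))))))"
    "w5 w = snd (prod_decode (snd (prod_decode (snd (prod_decode (snd (prod_decode w)))))))"
    for w :: nat
  define P where "P A w x \<longleftrightarrow> preimage_search U F Q A (w1 w) (w2 w) (w3 w) (w4 w) (w5 w) x" for A w x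
  \<comment> \<open>At the stage stored in a valid request the program has already halted without
    oracle, so a total expression reads off its output.\<close>
  define G where "G A w x = fuel U no_oracle (fst (prod_decode (w5 w))) [snd (prod_decode (w5 w))] - 1"
    for A :: "nat \<Rightarrow> bool" and w x :: nat
  have rec_w: "recursive_in 2 (\<lambda>A zs. w1 (hd zs))" "recursive_in 2 (\<lambda>A zs. w2 (hd zs))"
    "recursive_in 2 (\<lambda>A zs. w3 (hd zs))" "recursive_in 2 (\<lambda>A zs. w4 (hd zs))"
    "recursive_in 2 (\<lambda>A zs. w5 (hd zs))"
    unfolding w_defs
    by (intro recursive_in_fst_prod_decode recursive_in_snd_prod_decode recursive_in_vars; simp)+
  have "decidable_in 2 (\<lambda>A zs. P A (hd zs) (hd (tl zs)))"
    unfolding P_def by (intro decidable_in_preimage_search rec_w rec_Q recursive_in_vars) auto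
  moreover have "recursive_in 2 (\<lambda>A zs. G A (hd zs) (hd (tl zs)))"
    unfolding G_def
    by (intro recursive_in_intros recursive_in_fuel_no_oracle recursive_in_fst_prod_decode
        recursive_in_snd_prod_decode rec_w)
  moreover have pf: "w5 v = w5 w \<and> s = t" if "P A v (str_nat s)" "P A w (str_nat t)" "prefix s t"
    for A v w s t
    using preimage_search_prefix_free[OF assms] that unfolding P_def by blast
  ultimately obtain q where q: "\<And>A s. run A U (q @ s) = (if \<exists>w. P A w (str_nat s)
      then Some (nat_str (G A (LEAST w. P A w (str_nat s)) (str_nat s))) else None)"
    using universal_search[OF assms, of P G] by blast
  \<comment> \<open>The 2 comes from the \<open>Suc\<close> in \<open>preimage_length\<close> and
    the one in \<open>is_codeword\<close>.\<close>
  have "\<exists>s k. heavy U F s (str_nat y) k \<and> KH U x + k \<le> KH U y + K U x + (length q + 2)"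
    if Fx: "run no_oracle F x = Some y" for x y
  proof -
    let ?H = "halting_seq U" and ?y = "str_nat y"
    obtain p where p: "length p = K U x" "run no_oracle U p = Some x"
      using KA_witness[OF assms] unfolding K_def by blast
    define t where "t = (LEAST t. image_fuel U F t (str_nat p) = Suc ?y)"
    have t: "image_fuel U F t (str_nat p) = Suc ?y"
      "\<And>u. u < t \<Longrightarrow> image_fuel U F u (str_nat p) \<noteq> Suc ?y"
      unfolding t_def using ex_image_fuel[OF p(2) Fx] by (auto intro: LeastI_ex dest: not_less_Least)
    define e where "e = prod_encode (t, str_nat p)"
    have e: "preimage_request U F ?y e" unfolding preimage_request_def e_def using t by simp
    \<comment> \<open>The program \<open>p\<close> alone adds \<open>2 ^ -|p|\<close> to the mass of
      \<open>y\<close>. So a least \<open>k\<close> exists, and it is at most \<open>K U x\<close>,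
      which keeps the code length free of truncation.\<close>
    have p_heavy: "\<exists>s. heavy U F s ?y (length p)"
    proof -
      let ?s = "max t (Suc (str_nat p))"
      have "image_fuel U F ?s (str_nat p) = Suc ?y" using image_fuel_mono[OF t(1)] by simp
      then have "heavy U F ?s ?y (length p)"
        using mass_ge[of "{str_nat p}" ?s U F ?y] by (simp add: heavy_def)
      then show ?thesis by blast
    qed
    define k where "k = (LEAST k. \<exists>s. heavy U F s ?y k)"
    obtain s where k: "heavy U F s ?y k" using LeastI[of "\<lambda>k. \<exists>s. heavy U F s ?y k", OF p_heavy] unfolding k_def by blast
    have k_least: "\<not> heavy U F s ?y j" if "j < k" for s j
      using not_less_Least that unfolding k_def by blast
    have k_le: "k \<le> K U x" unfolding k_def p(1)[symmetric] by (rule Least_le) (rule p_heavy)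
    obtain r where r: "is_codeword (preimage_request U F ?y) (preimage_length k) e r"
      using ex_codeword[of "preimage_request U F ?y", OF e]
        preimage_request_sum_le_1[OF assms k_least] by metis
    obtain p' where p': "length p' = KH U y" "run ?H U p' = Some y"
      using KA_witness[OF assms] unfolding KH_def by blast
    then obtain u where u: "fuel U ?H u [str_nat p'] = Suc ?y" unfolding run_eq_Some_iff_fuel by blast
    define w where "w = prod_encode (str_nat p', prod_encode (str_nat r, prod_encode (u, prod_encode (k, e))))"
    have w: "P ?H w (str_nat (p' @ r))"
      unfolding P_def preimage_search_def w_defs w_def
      using u r k k_least by (auto simp: str_nat_append Q)
    define v where "v = (LEAST w. P ?H w (str_nat (p' @ r)))"
    \<comment> \<open>The least witness may use less fuel than \<open>w\<close>, but its request is
      the same, and \<open>G\<close> depends only on that.\<close>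
    have "P ?H v (str_nat (p' @ r))" unfolding v_def using w by (rule LeastI)
    then have "w5 v = w5 w" using pf w by blast
    also have "w5 w = e" by (simp add: w_defs w_def)
    finally have "G ?H v (str_nat (p' @ r)) = fuel U no_oracle t [str_nat p] - 1"
      by (simp add: G_def e_def)
    also have "\<dots> = str_nat x"
    proof -
      obtain z where z: "fuel U no_oracle t [str_nat p] = Suc z"
        using t(1) unfolding image_fuel_def by (cases "fuel U no_oracle t [str_nat p]") auto
      then have "nat_str z = x" using fuel_run p(2) by fastforce
      then show ?thesis using z by auto
    qed
    finally have "run ?H U (q @ p' @ r) = Some x"
      using q[of ?H "p' @ r"] w unfolding v_def[symmetric] by auto
    then have "KH U x \<le> length (q @ p' @ r)" unfolding KH_def by (rule KA_le)
    then have "KH U x + k \<le> KH U y + K U x + (length q + 2)"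
      using r k_le p(1) p'(1) by (simp add: is_codeword_def preimage_length_def e_def)
    then show ?thesis using k by blast
  qed
  then show thesis by (rule that)
qed

theorem theorem4:
  fixes U :: rf and f :: "bool list \<Rightarrow> bool list"
  assumes "universal U" and "partial_recursive f"
  shows "\<exists>c::int. \<forall>x. IH U (f x) < IH U x + c"
proof -
  obtain F where F: "\<And>x. f x = (case run no_oracle F x of None \<Rightarrow> [] | Some y \<Rightarrow> y)"
    using assms(2) unfolding partial_recursive_def by blast
  obtain a where a: "\<And>x. KH U x \<le> K U x + a" using KH_le_K[OF assms(1)] by blast
  obtain b where b: "\<And>s y k. heavy U F s y k \<Longrightarrow> K U (nat_str y) \<le> k + b"
    using K_le_of_heavy[OF assms(1)] by blast
  obtain d where d: "\<And>x y. run no_oracle F x = Some y \<Longrightarrow>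
      \<exists>s k. heavy U F s (str_nat y) k \<and> KH U x + k \<le> KH U y + K U x + d"
    using KH_le_of_image[OF assms(1)] by blast
  \<comment> \<open>The term with \<open>IH U []\<close> is for inputs where \<open>F\<close> is
    undefined and \<open>f x\<close> is empty; the final 1 gives strictness.\<close>
  have "IH U (f x) < IH U x + (\<bar>IH U []\<bar> + int a + int b + int d + 1)" for x
  proof (cases "run no_oracle F x")
    case None
    then show ?thesis using a[of x] by (simp add: F IH_def)
  next
    case (Some y)
    then obtain s k where "heavy U F s (str_nat y) k" "KH U x + k \<le> KH U y + K U x + d"
      using d by blast
    then have "K U y + KH U x \<le> K U x + KH U y + b + d" using b[of s "str_nat y" k] by simp
    then show ?thesis using Some by (simp add: F IH_def)
  qed
  then show ?thesis by blast
qed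

end
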